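(* Let $(\Omega,\mathcal F,\mathbb P)$ be a probability space, let $\mathfrak d,\delta\in\mathbb N$, let $U_{n,m}\colon\Omega\to\mathbb R^\delta$, $(n,m)\in\mathbb N_0^2$, be i.i.d. random variables, let $G\colon\mathbb R^{\mathfrak d}\times\mathbb R^\delta\to\mathbb R^{\mathfrak d}$ be measurable, let $\xi,\vartheta\in\mathbb R^{\mathfrak d}$, $\alpha\in[0,1)$, $c,\Gamma\in(0,\infty)$, $\lambda\in(0,1)$. For every $J\in\mathbb N$ let $\Theta^J\colon\mathbb N_0\times\Omega\to\mathbb R^{\mathfrak d}$ and $\mathbf m^J\colon\mathbb N_0\times\Omega\to\mathbb R^{\mathfrak d}$ satisfy for all $n\in\mathbb N$ that $$\Theta_0^J=\xi,\qquad \mathbf m_0^J=0,\qquad \Theta_n^J=\Theta_{n-1}^J-\Gamma n^{-\lambda}\mathbf m_n^J,$$ $$\mathbf m_n^J=\alpha\mathbf m_{n-1}^J+(1-\alpha)\Bigl[\frac1J\sum_{j=1}^J G(\Theta_{n-1}^J,U_{n,j})\Bigr].$$ Assume for all $\theta\in\mathbb R^{\mathfrak d}$ that $\sup_{J,n\in\mathbb N}\mathbb E\bigl[\|G(\theta,U_{0,1})\|+\|G(\Theta_{n-1}^J,U_{0,1})\|^2\bigr]<\infty$ and $$\langle\theta-\vartheta,\mathbb E[G(\theta,U_{1,1})]\rangle\ge c\max\{\|\theta-\vartheta\|^2,\|\mathbb E[G(\theta,U_{1,1})]\|^2\}.$$ Then there exists $\mathfrak C\in(0,\infty)$ such that for all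 $J,n\in\mathbb N$ it holds that $$\mathbb E\bigl[\|\Theta_n^J-\vartheta\|^2\bigr]\le\mathfrak C\bigl(\exp(-\mathfrak C^{-1}n^{1-\lambda})+J^{-1}n^{-\lambda}\bigr).$$
   Context: $\mathbb N=\{1,2,3,\dots\}$, $\mathbb N_0=\{0,1,2,\dots\}$; $\langle\cdot,\cdot\rangle$ and $\|\cdot\|$ are the standard Euclidean inner product and norm. For a process $X\colon\mathbb N_0\times\Omega\to\mathbb R^{\mathfrak d}$, $X_n$ denotes $X(n,\cdot)$. *)

theory Defs
  imports "HOL-Probability.Probability"
begin

end

theory Submission
  imports Defs
begin

text \<open>
  Write \<open>x\<close> for the error \<open>\<Theta> - \<theta>star\<close>, \<open>\<gamma> n = \<Gamma> n\<^sup>-\<^sup>l\<close> for the step sizes and \<open>g\<close> for the averaged gradient.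
  With \<open>b n = (\<Sum>k\<ge>1. \<alpha>\<^sup>k \<gamma> (n + k))\<close> the shifted process \<open>z = x - b m\<close> makes momentum-free steps
  \<open>z (n + 1) = z n - a (g (\<Theta> n) + D)\<close>, where the noise \<open>D\<close> is orthogonal to every square-integrable
  function of the past and has second moment at most \<open>K / J\<close>. Coercivity of \<open>g\<close> at \<open>x\<close> dominates the
  error from replacing \<open>z\<close> by \<open>x\<close> once \<open>\<gamma>\<close> is small, so that \<open>V = E (|z|\<^sup>2 + \<gamma>\<^sup>2 |m|\<^sup>2)\<close> satisfies
  \<open>V (n + 1) \<le> (1 - \<eta> \<gamma> (n + 1)) V n + 2 \<gamma> (n + 1)\<^sup>2 K / J\<close> for large \<open>n\<close>. The momentum weight \<open>\<gamma>\<^sup>2\<close> rather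
  than \<open>\<gamma>\<close> keeps the noise contribution quadratic in \<open>\<gamma>\<close>. Solving this recursion gives the claim.
\<close>

subsection \<open>Step sizes and the Lyapunov inequality\<close>

lemma one_minus_le_exp: "1 - x \<le> exp (- x)" for x :: real
  using exp_ge_add_one_self[of "-x"] by simp

text \<open>Both parts rest on the monotonicity of powers: the first after writing
  \<open>t powr (1 - l)\<close> as \<open>t * t powr (- l)\<close>, the second because a base of at
  least 1 raised to \<open>l < 1\<close> stays below the base. They control the growth of the
  exponent and the ratio of consecutive step sizes in the scalar recursion.\<close>

lemma powr_step_le:
  fixes l x :: real
  assumes "1 \<le> x" "0 < l" "l < 1"
  shows "(x + 1) powr (1 - l) \<le> x powr (1 - l) + (x + 1) powr (- l)"
    and "x powr (- l) \<le> (x + 1) powr (- l) * (1 + 1 / x)"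
proof -
  have split: "t powr (1 - l) = t * t powr (- l)" if "0 < t" for t :: real
    using that powr_add[of t 1 "- l"] by simp
  have "x * (x + 1) powr (- l) \<le> x * x powr (- l)"
    using assms by (intro mult_left_mono powr_mono2') auto
  then show "(x + 1) powr (1 - l) \<le> x powr (1 - l) + (x + 1) powr (- l)"
    using assms by (simp add: split distrib_right)
  have eq: "(x + 1) / x = 1 + 1 / x" using assms by (simp add: field_simps)
  have "((x + 1) / x) powr l \<le> ((x + 1) / x) powr 1"
    using assms unfolding eq by (intro powr_mono) auto
  also have "\<dots> = 1 + 1 / x" using assms eq by simp
  finally have "(x + 1) powr (- l) * ((x + 1) / x) powr l \<le> (x + 1) powr (- l) * (1 + 1 / x)"
    by (intro mult_left_mono) auto
  moreover have "(x + 1) powr (- l) * ((x + 1) / x) powr l = x powr (- l)"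
    using assms by (subst powr_divide) (auto simp: powr_minus field_simps)
  ultimately show "x powr (- l) \<le> (x + 1) powr (- l) * (1 + 1 / x)" by simp
qed

text \<open>Induction with a two-term ansatz. The exponential dominates the homogeneous solution, as
  \<open>n powr (1 - l)\<close> grows by at most \<open>n powr (- l)\<close> per step; the factor
  \<open>exp (h * real N powr (1 - l))\<close> normalises it to \<open>B\<close> at
  \<open>N\<close>. The second term is a supersolution for the noise that follows the decay of the
  step sizes.\<close>

lemma recursion_bound:
  fixes v :: "nat \<Rightarrow> real" and l h q B :: real
  assumes l: "0 < l" "l < 1" and "0 < h" "0 \<le> q" "0 \<le> B" "1 \<le> N"
    and small: "\<And>n. N < n \<Longrightarrow> h * real n powr (- l) \<le> 1"
    and slow: "\<And>n. N < n \<Longrightarrow> 1 / real (n - 1) \<le> h / 2 * real n powr (- l)"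
    and step: "\<And>n. N < n \<Longrightarrow> v n \<le> (1 - h * real n powr (- l)) * v (n - 1) + q * (real n powr (- l))\<^sup>2"
    and init: "v N \<le> B" and "N \<le> n"
  shows "v n \<le> B * exp (h * real N powr (1 - l)) * exp (- (h * real n powr (1 - l)))
           + 2 * q / h * real n powr (- l)"
  using \<open>N \<le> n\<close>
proof (induction n rule: dec_induct)
  case base
  have "v N \<le> B * (exp (h * real N powr (1 - l)) * exp (- (h * real N powr (1 - l))))"
    using init by (simp add: exp_minus)
  moreover have "0 \<le> 2 * q / h * real N powr (- l)" using assms by simp
  ultimately show ?case by (simp add: mult.assoc)
next
  case (step k)
  define n where "n = Suc k"
  define p where "p = real n powr (- l)"
  have n: "N < n" "1 \<le> real k" "n - 1 = k" "real n = real k + 1" using step assms(6) by (auto simp: n_def)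
  have p: "0 < p" using n(2,4) by (simp add: p_def)
  have hp: "h * p \<le> 1" using small[OF n(1)] by (simp add: p_def)
  let ?E = "B * exp (h * real N powr (1 - l))"
  have E0: "0 \<le> ?E" using assms by simp
  have k1: "(1 - h * p) * exp (- (h * real k powr (1 - l))) \<le> exp (- (h * real n powr (1 - l)))"
  proof -
    have "(1 - h * p) * exp (- (h * real k powr (1 - l))) \<le> exp (- (h * p)) * exp (- (h * real k powr (1 - l)))"
      by (intro mult_right_mono one_minus_le_exp) auto
    also have "\<dots> = exp (- (h * (real k powr (1 - l) + p)))"
      by (simp add: exp_add[symmetric] algebra_simps)
    also have "\<dots> \<le> exp (- (h * real n powr (1 - l)))"
      using powr_step_le(1)[OF n(2) l] assms(3) n(4) by (simp add: p_def)
    finally show ?thesis .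
  qed
  define Q where "Q = 2 * q / h"
  have Q: "0 \<le> Q" "q = Q * h / 2" using assms by (auto simp: Q_def)
  \<comment> \<open>One step contracts \<open>Q * p\<close> by
    \<open>h * p * Q * p = 2 * q * p^2\<close>. Half of this pays for the new noise
    \<open>q * p^2\<close>, the other half for the drop of the step size from \<open>k\<close> to
    \<open>n\<close>, which \<open>slow\<close> bounds by a relative amount
    \<open>h * p / 2\<close>.\<close>
  have k2: "(1 - h * p) * (Q * real k powr (- l)) + q * p\<^sup>2 \<le> Q * p"
  proof -
    define r where "r = 1 / real k"
    have r: "0 \<le> r" "r \<le> h / 2 * p" using slow[OF n(1)] n by (auto simp: r_def p_def)
    have "(1 - h * p) * (1 + r) \<le> 1 - h * p / 2"
    proof -
      have "0 \<le> h * p * r" using r p assms by simp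
      then show ?thesis using r(2) by (simp add: algebra_simps)
    qed
    then have "p * ((1 - h * p) * (1 + r)) \<le> p * (1 - h * p / 2)" using p by simp
    moreover have "(1 - h * p) * real k powr (- l) \<le> (1 - h * p) * (p * (1 + r))"
      using powr_step_le(2)[OF n(2) l] hp n(4) by (intro mult_left_mono) (auto simp: p_def r_def)
    ultimately have "(1 - h * p) * real k powr (- l) \<le> p * (1 - h * p / 2)"
      by (simp add: algebra_simps)
    then have "Q * ((1 - h * p) * real k powr (- l)) \<le> Q * (p * (1 - h * p / 2))"
      using Q by (intro mult_left_mono) auto
    also have "\<dots> = Q * p - q * p\<^sup>2" using Q by (simp add: algebra_simps power2_eq_square)
    finally show ?thesis by (simp add: algebra_simps)
  qed
  \<comment> \<open>\<open>assms(9)\<close> is the recursion hypothesis; the name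
    \<open>step\<close> now refers to the induction case.\<close>
  have "v n \<le> (1 - h * p) * v k + q * p\<^sup>2" using assms(9)[OF n(1)] n(3) by (simp add: p_def)
  also have "\<dots> \<le> (1 - h * p) * (?E * exp (- (h * real k powr (1 - l))) + Q * real k powr (- l)) + q * p\<^sup>2"
    using hp step.IH unfolding Q_def by (intro add_right_mono mult_left_mono) auto
  also have "\<dots> = ?E * ((1 - h * p) * exp (- (h * real k powr (1 - l))))
      + ((1 - h * p) * (Q * real k powr (- l)) + q * p\<^sup>2)"
    by (simp add: algebra_simps)
  also have "\<dots> \<le> ?E * exp (- (h * real n powr (1 - l))) + Q * p"
    by (intro add_mono mult_left_mono k1 k2 E0)
  finally show ?case by (simp add: n_def p_def Q_def)
qed

text \<open>The weights \<open>b\<close> are chosen such that \<open>x - b *\<^sub>R m\<close> performs gradient descent without momentum.\<close>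

lemma momentum_weights:
  fixes \<gamma> :: "nat \<Rightarrow> real" and \<alpha> :: real
  assumes "0 \<le> \<alpha>" "\<alpha> < 1" and pos: "\<And>n. 1 \<le> n \<Longrightarrow> 0 \<le> \<gamma> n"
    and dec: "\<And>n k. 1 \<le> n \<Longrightarrow> n \<le> k \<Longrightarrow> \<gamma> k \<le> \<gamma> n"
  obtains b where "\<And>n. b n = \<alpha> * (\<gamma> (Suc n) + b (Suc n))"
    and "\<And>n. 0 \<le> b n" and "\<And>n. b n \<le> \<alpha> / (1 - \<alpha>) * \<gamma> (Suc n)"
proof -
  \<comment> \<open>Unrolling the recursion for \<open>b\<close> towards larger indices gives the
    series over \<open>f n\<close>. Since the step sizes decrease, it is dominated by a geometric
    series, whose sum is the claimed upper bound.\<close>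
  define f where "f n k = \<alpha> ^ Suc k * \<gamma> (Suc n + k)" for n k
  have geo: "(\<lambda>k. \<alpha> ^ Suc k * C) sums (\<alpha> / (1 - \<alpha>) * C)" for C
    using sums_mult[OF geometric_sums[of \<alpha>], of "\<alpha> * C"] assms by (simp add: mult_ac)
  have f0': "f n 0 = \<alpha> * \<gamma> (Suc n)" for n by (simp add: f_def)
  have f0: "0 \<le> f n k" for n k using assms by (simp add: f_def)
  have fle: "f n k \<le> \<alpha> ^ Suc k * \<gamma> (Suc n)" for n k
    unfolding f_def using assms by (intro mult_left_mono dec) auto
  have sf: "summable (f n)" for n
    by (rule summable_comparison_test[OF _ sums_summable[OF geo[of "\<gamma> (Suc n)"]]])
      (use f0 fle in \<open>auto intro!: exI[of _ 0]\<close>)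
  show ?thesis
  proof
    fix n
    have "suminf (f n) = f n 0 + (\<Sum>k. f n (Suc k))" using suminf_split_head[OF sf[of n]] by simp
    also have "(\<Sum>k. f n (Suc k)) = (\<Sum>k. \<alpha> * f (Suc n) k)" by (simp add: f_def mult_ac)
    also have "\<dots> = \<alpha> * suminf (f (Suc n))" by (rule suminf_mult[OF sf])
    finally show "suminf (f n) = \<alpha> * (\<gamma> (Suc n) + suminf (f (Suc n)))"
      by (simp add: f0' algebra_simps)
    show "0 \<le> suminf (f n)" by (intro suminf_nonneg sf f0)
    show "suminf (f n) \<le> \<alpha> / (1 - \<alpha>) * \<gamma> (Suc n)"
      using suminf_le[OF fle sf sums_summable[OF geo]] sums_unique[OF geo] by metis
  qed
qed

section \<open>Inner product inequalities and the deterministic one-step contraction\<close>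

text \<open>The gap between the two sides is exactly
  \<open>t * (1 - t) * (norm (x - y))^2\<close>.\<close>

lemma norm_convex_square:
  fixes x y :: "'a::real_inner"
  assumes "0 \<le> t" "t \<le> 1"
  shows "(norm (t *\<^sub>R x + (1 - t) *\<^sub>R y))\<^sup>2 \<le> t * (norm x)\<^sup>2 + (1 - t) * (norm y)\<^sup>2"
proof -
  have "t * (norm x)\<^sup>2 + (1 - t) * (norm y)\<^sup>2 - (norm (t *\<^sub>R x + (1 - t) *\<^sub>R y))\<^sup>2
      = t * (1 - t) * (norm (x - y))\<^sup>2"
    unfolding power2_norm_eq_inner by (simp add: inner_simps inner_commute algebra_simps)
  moreover have "0 \<le> t * (1 - t) * (norm (x - y))\<^sup>2" using assms by simp
  ultimately show ?thesis by linarith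
qed

lemma norm_diff_square_le:
  fixes x y :: "'a::real_inner"
  shows "(norm (x - y))\<^sup>2 \<le> 2 * (norm x)\<^sup>2 + 2 * (norm y)\<^sup>2"
proof -
  have "0 \<le> (norm (x + y))\<^sup>2" by simp
  then show ?thesis unfolding power2_norm_eq_inner by (simp add: inner_simps inner_commute algebra_simps)
qed

text \<open>Young's inequality, from expanding the square of \<open>e *\<^sub>R x - y\<close> and
  dividing by \<open>e\<close>.\<close>

lemma inner_le_weighted_squares:
  fixes x y :: "'a::real_inner"
  assumes "0 < e"
  shows "2 * inner x y \<le> e * (norm x)\<^sup>2 + 1 / e * (norm y)\<^sup>2"
proof -
  have "0 \<le> 1 / e * (norm (e *\<^sub>R x - y))\<^sup>2" using assms by simp
  also have "\<dots> = e * (norm x)\<^sup>2 + 1 / e * (norm y)\<^sup>2 - 2 * inner x y"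
    unfolding power2_norm_eq_inner using assms
    by (simp add: inner_simps inner_commute field_simps)
  finally show ?thesis by linarith
qed

text \<open>A budget of quadratic terms. Coercivity supplies \<open>a * c\<close> times both
  \<open>|x|^2\<close> and \<open>|g|^2\<close>, and averaging the momentum supplies
  \<open>2 * p\<close> times \<open>\<gamma>^2 * |m|^2\<close>. The first smallness condition lets
  the \<open>|g|^2\<close> supply absorb all terms in \<open>g\<close>; the cross term uses half of
  the momentum supply. The second condition lets the other half pay for passing from
  \<open>|x|^2\<close> back to the shifted error. Here \<open>\<gamma>\<close> is the new and
  \<open>\<gamma>'\<close> the previous step size.\<close>

lemma momentum_lyapunov_step:
  fixes x m g :: "'a::real_inner" and \<alpha> c \<gamma> \<gamma>' a b A p :: real
  defines "A \<equiv> \<alpha> / (1 - \<alpha>)" and "p \<equiv> (1 - \<alpha>) / 2"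
  assumes \<alpha>: "0 \<le> \<alpha>" "\<alpha> < 1" and c: "0 < c" and \<gamma>: "0 < \<gamma>" "\<gamma> \<le> \<gamma>'"
    and a: "(1 - \<alpha>) * \<gamma> \<le> a" "a \<le> \<gamma>" and b: "0 \<le> b" "b \<le> A * \<gamma>"
    and coercive: "c * (norm x)\<^sup>2 \<le> inner x g" "c * (norm g)\<^sup>2 \<le> inner x g"
    and small: "\<gamma> * (2 + A\<^sup>2 / p) \<le> (1 - \<alpha>) * c" "\<gamma> * (c * (2 * A\<^sup>2 + 1)) \<le> 1"
  shows "(norm (x - b *\<^sub>R m - a *\<^sub>R g))\<^sup>2 + \<gamma>\<^sup>2 * (norm (\<alpha> *\<^sub>R m + (1 - \<alpha>) *\<^sub>R g))\<^sup>2
    \<le> (1 - p * c * \<gamma>) * ((norm (x - b *\<^sub>R m))\<^sup>2 + \<gamma>'\<^sup>2 * (norm m)\<^sup>2)"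
proof -
  have p: "0 < p" "1 - \<alpha> = 2 * p" using \<alpha> by (auto simp: p_def)
  have A: "0 \<le> A" using \<alpha> by (simp add: A_def)
  have a0: "0 \<le> a" using a \<alpha> \<gamma> by (smt (verit) mult_nonneg_nonneg)
  let ?x = "(norm x)\<^sup>2" and ?m = "(norm m)\<^sup>2" and ?g = "(norm g)\<^sup>2" and ?z = "(norm (x - b *\<^sub>R m))\<^sup>2"
  have exp1: "(norm (x - b *\<^sub>R m - a *\<^sub>R g))\<^sup>2 = ?z - 2 * a * inner x g + 2 * inner ((a * b) *\<^sub>R m) g + a\<^sup>2 * ?g"
    unfolding power2_norm_eq_inner by (simp add: inner_simps inner_commute algebra_simps power2_eq_square)
  \<comment> \<open>Each of the two coercivity bounds is used for one of the two copies of
    \<open>inner x g\<close>.\<close>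
  have xg: "a * c * ?x + a * c * ?g \<le> 2 * a * inner x g"
    using mult_left_mono[OF coercive(1) a0] mult_left_mono[OF coercive(2) a0] by (simp add: algebra_simps)
  have ac: "2 * p * \<gamma> * c \<le> a * c" using a(1) c p by (simp add: mult_right_mono)
  \<comment> \<open>This is the price of evaluating the gradient at \<open>x\<close> instead of the
    shifted point. Young's inequality with weight \<open>p\<close> keeps the momentum part below
    half of the available contraction \<open>2 * p\<close>.\<close>
  have cross: "2 * inner ((a * b) *\<^sub>R m) g \<le> p * \<gamma>\<^sup>2 * ?m + A\<^sup>2 / p * \<gamma>\<^sup>2 * ?g"
  proof -
    have ab: "0 \<le> a * b" "a * b \<le> A * \<gamma>\<^sup>2"
      using mult_mono[OF a(2) b(2)] a0 b(1) \<gamma> by (auto simp: power2_eq_square mult_ac)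
    have "2 * inner ((a * b) *\<^sub>R m) g \<le> 2 * (a * b) * (norm m * norm g)"
      using mult_left_mono[OF norm_cauchy_schwarz[of m g] ab(1)] by simp
    also have "\<dots> \<le> 2 * (A * \<gamma>\<^sup>2) * (norm m * norm g)"
      using ab by (intro mult_right_mono) auto
    also have "\<dots> = \<gamma>\<^sup>2 * (2 * inner (norm m) (A * norm g))" by simp
    also have "\<dots> \<le> \<gamma>\<^sup>2 * (p * ?m + 1 / p * (A * norm g)\<^sup>2)"
      using inner_le_weighted_squares[OF p(1), of "norm m" "A * norm g"] A
      by (intro mult_left_mono) (auto simp: abs_mult)
    also have "\<dots> = p * \<gamma>\<^sup>2 * ?m + A\<^sup>2 / p * \<gamma>\<^sup>2 * ?g" by (simp add: algebra_simps power_mult_distrib)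
    finally show ?thesis .
  qed
  have mom: "\<gamma>\<^sup>2 * (norm (\<alpha> *\<^sub>R m + (1 - \<alpha>) *\<^sub>R g))\<^sup>2 \<le> \<gamma>\<^sup>2 * ((1 - 2 * p) * ?m + ?g)"
  proof (intro mult_left_mono)
    have "(1 - \<alpha>) * ?g \<le> 1 * ?g" using \<alpha> by (intro mult_right_mono) auto
    then show "(norm (\<alpha> *\<^sub>R m + (1 - \<alpha>) *\<^sub>R g))\<^sup>2 \<le> (1 - 2 * p) * ?m + ?g"
      using norm_convex_square[of \<alpha> m g] \<alpha> unfolding p(2)[symmetric] by simp
  qed auto
  have gg: "a\<^sup>2 * ?g \<le> \<gamma>\<^sup>2 * ?g" using a a0 by (intro mult_right_mono power_mono) auto
  have gcoef: "\<gamma>\<^sup>2 * ?g + A\<^sup>2 / p * \<gamma>\<^sup>2 * ?g + \<gamma>\<^sup>2 * ?g \<le> a * c * ?g"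
  proof -
    have "\<gamma> * (\<gamma> * (2 + A\<^sup>2 / p)) \<le> \<gamma> * ((1 - \<alpha>) * c)" using small \<gamma> by (intro mult_left_mono) auto
    then have "\<gamma>\<^sup>2 + A\<^sup>2 / p * \<gamma>\<^sup>2 + \<gamma>\<^sup>2 \<le> a * c" using ac p by (simp add: algebra_simps power2_eq_square)
    from mult_right_mono[OF this, of ?g] show ?thesis by (simp add: algebra_simps)
  qed
  have \<gamma>2: "\<gamma>\<^sup>2 \<le> \<gamma>'\<^sup>2" using \<gamma> by (intro power_mono) auto
  have L1: "(norm (x - b *\<^sub>R m - a *\<^sub>R g))\<^sup>2 + \<gamma>\<^sup>2 * (norm (\<alpha> *\<^sub>R m + (1 - \<alpha>) *\<^sub>R g))\<^sup>2
      \<le> ?z - 2 * p * \<gamma> * c * ?x + \<gamma>\<^sup>2 * ((1 - p) * ?m)"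
    using exp1 xg cross mom gg gcoef mult_right_mono[OF ac, of ?x] by (simp add: algebra_simps)
  have "\<gamma>\<^sup>2 * ((1 - p) * ?m) \<le> \<gamma>'\<^sup>2 * ((1 - p) * ?m)"
    using \<alpha> \<gamma>2 by (intro mult_right_mono) (auto simp: p_def)
  with L1 have L2: "(norm (x - b *\<^sub>R m - a *\<^sub>R g))\<^sup>2 + \<gamma>\<^sup>2 * (norm (\<alpha> *\<^sub>R m + (1 - \<alpha>) *\<^sub>R g))\<^sup>2
      \<le> ?z + \<gamma>'\<^sup>2 * ?m - 2 * p * \<gamma> * c * ?x - p * (\<gamma>'\<^sup>2 * ?m)" by (simp add: algebra_simps)
  \<comment> \<open>Turns the decrease in \<open>|x|^2\<close> into a decrease in \<open>?z\<close>;
    the bound \<open>b \<le> A * \<gamma>\<close> makes the correction comparable to the momentum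
    term of the Lyapunov function.\<close>
  have "?z \<le> 2 * ?x + 2 * A\<^sup>2 * (\<gamma>'\<^sup>2 * ?m)"
  proof -
    have "b\<^sup>2 \<le> (A * \<gamma>)\<^sup>2" using b by (intro power_mono) auto
    also have "\<dots> \<le> A\<^sup>2 * \<gamma>'\<^sup>2" using \<gamma>2 by (simp add: power_mult_distrib mult_left_mono)
    finally have "b\<^sup>2 * ?m \<le> A\<^sup>2 * \<gamma>'\<^sup>2 * ?m" by (intro mult_right_mono) auto
    then show ?thesis using norm_diff_square_le[of x "b *\<^sub>R m"] by (simp add: power_mult_distrib algebra_simps)
  qed
  then have "p * c * \<gamma> * (?z + \<gamma>'\<^sup>2 * ?m) \<le> p * c * \<gamma> * (2 * ?x + (2 * A\<^sup>2 + 1) * (\<gamma>'\<^sup>2 * ?m))"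
    using p c \<gamma> by (intro mult_left_mono) (auto simp: algebra_simps)
  also have "\<dots> = 2 * p * \<gamma> * c * ?x + p * (\<gamma> * (c * (2 * A\<^sup>2 + 1))) * (\<gamma>'\<^sup>2 * ?m)" by (simp add: algebra_simps)
  also have "\<dots> \<le> 2 * p * \<gamma> * c * ?x + p * 1 * (\<gamma>'\<^sup>2 * ?m)"
    using small(2) p by (intro add_left_mono mult_right_mono mult_left_mono) auto
  finally show ?thesis using L2 by (simp add: algebra_simps)
qed

subsection \<open>Square-integrable random variables and independence\<close>

text \<open>Measurability of \<open>X\<close> is demanded separately because integrability of the
  squared norm does not imply it.\<close>

definition square_integrable :: "'a measure \<Rightarrow> ('a \<Rightarrow> 'b::euclidean_space) \<Rightarrow> bool" where
  "square_integrable M X \<longleftrightarrow> X \<in> borel_measurable M \<and> integrable M (\<lambda>\<omega>. (norm (X \<omega>))\<^sup>2)"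

lemma square_integrable_measurable: "square_integrable M X \<Longrightarrow> X \<in> borel_measurable M"
  and square_integrable_norm: "square_integrable M X \<Longrightarrow> integrable M (\<lambda>\<omega>. (norm (X \<omega>))\<^sup>2)"
  by (auto simp: square_integrable_def)

lemma square_integrable_scaleR:
  "square_integrable M X \<Longrightarrow> square_integrable M (\<lambda>\<omega>. r *\<^sub>R X \<omega>)"
  by (auto simp: square_integrable_def power_mult_distrib)

lemma square_integrable_diff:
  assumes "square_integrable M X" "square_integrable M Y"
  shows "square_integrable M (\<lambda>\<omega>. X \<omega> - Y \<omega>)"
proof -
  note [measurable] = assms[THEN square_integrable_measurable]
  have "integrable M (\<lambda>\<omega>. 2 * (norm (X \<omega>))\<^sup>2 + 2 * (norm (Y \<omega>))\<^sup>2)"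
    using assms[THEN square_integrable_norm] by simp
  then have "integrable M (\<lambda>\<omega>. (norm (X \<omega> - Y \<omega>))\<^sup>2)"
    by (rule Bochner_Integration.integrable_bound) (use norm_diff_square_le in \<open>auto intro!: AE_I2 order_trans[OF _ abs_ge_self]\<close>)
  then show ?thesis by (simp add: square_integrable_def)
qed

lemma square_integrable_add:
  assumes "square_integrable M X" "square_integrable M Y"
  shows "square_integrable M (\<lambda>\<omega>. X \<omega> + Y \<omega>)"
  using square_integrable_diff[OF assms(1) square_integrable_scaleR[OF assms(2), of "-1"]] by simp

lemma square_integrable_zero: "square_integrable M (\<lambda>_. 0)"
  by (simp add: square_integrable_def)

lemma square_integrable_sum:
  "(\<And>i. i \<in> I \<Longrightarrow> square_integrable M (X i)) \<Longrightarrow> square_integrable M (\<lambda>\<omega>. \<Sum>i\<in>I. X i \<omega>)"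
  by (induction I rule: infinite_finite_induct)
    (auto intro: square_integrable_add square_integrable_zero)

lemma square_integrable_bound:
  assumes "square_integrable M X" "Y \<in> borel_measurable M" "\<And>\<omega>. norm (Y \<omega>) \<le> C * norm (X \<omega>)"
  shows "square_integrable M Y"
proof -
  note [measurable] = assms(2)
  have "integrable M (\<lambda>\<omega>. C\<^sup>2 * (norm (X \<omega>))\<^sup>2)"
    using assms(1)[THEN square_integrable_norm] by simp
  moreover have "(norm (Y \<omega>))\<^sup>2 \<le> C\<^sup>2 * (norm (X \<omega>))\<^sup>2" for \<omega>
    using power_mono[OF assms(3), of \<omega> 2] by (simp add: power_mult_distrib)
  ultimately have "integrable M (\<lambda>\<omega>. (norm (Y \<omega>))\<^sup>2)"
    by (elim Bochner_Integration.integrable_bound) (auto intro!: AE_I2)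
  then show ?thesis using assms(2) by (simp add: square_integrable_def)
qed

lemma square_integrable_inner:
  assumes "square_integrable M X" "square_integrable M Y"
  shows "integrable M (\<lambda>\<omega>. inner (X \<omega>) (Y \<omega>))"
proof -
  note [measurable] = assms[THEN square_integrable_measurable]
  have "integrable M (\<lambda>\<omega>. (norm (X \<omega>))\<^sup>2 + (norm (Y \<omega>))\<^sup>2)"
    using assms[THEN square_integrable_norm] by simp
  moreover have "\<bar>inner (X \<omega>) (Y \<omega>)\<bar> \<le> (norm (X \<omega>))\<^sup>2 + (norm (Y \<omega>))\<^sup>2" for \<omega>
    using inner_le_weighted_squares[of 1 "X \<omega>" "Y \<omega>"] inner_le_weighted_squares[of 1 "X \<omega>" "- Y \<omega>"]
    by (simp add: abs_le_iff)
  ultimately show ?thesis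
    by (elim Bochner_Integration.integrable_bound) (auto intro!: AE_I2)
qed

section \<open>Orthogonality in L2\<close>

lemma integral_norm_square_add_orthogonal:
  assumes "square_integrable M X" "square_integrable M Y" "(\<integral>\<omega>. inner (X \<omega>) (Y \<omega>) \<partial>M) = 0"
  shows "(\<integral>\<omega>. (norm (X \<omega> + Y \<omega>))\<^sup>2 \<partial>M) = (\<integral>\<omega>. (norm (X \<omega>))\<^sup>2 \<partial>M) + (\<integral>\<omega>. (norm (Y \<omega>))\<^sup>2 \<partial>M)"
proof -
  have "(norm (X \<omega> + Y \<omega>))\<^sup>2 = (norm (X \<omega>))\<^sup>2 + 2 * inner (X \<omega>) (Y \<omega>) + (norm (Y \<omega>))\<^sup>2" for \<omega>
    unfolding power2_norm_eq_inner by (simp add: inner_simps inner_commute)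
  then show ?thesis
    using assms square_integrable_inner[OF assms(1,2)] by (simp add: square_integrable_norm)
qed

text \<open>Pythagoras by induction on the index set. Applied to the noise of the samples in a
  batch, it is the source of the factor \<open>1 / J\<close>.\<close>

lemma integral_norm_square_sum_orthogonal:
  assumes "finite I" "\<And>i. i \<in> I \<Longrightarrow> square_integrable M (X i)"
    and "\<And>i j. i \<in> I \<Longrightarrow> j \<in> I \<Longrightarrow> i \<noteq> j \<Longrightarrow> (\<integral>\<omega>. inner (X i \<omega>) (X j \<omega>) \<partial>M) = 0"
  shows "(\<integral>\<omega>. (norm (\<Sum>i\<in>I. X i \<omega>))\<^sup>2 \<partial>M) = (\<Sum>i\<in>I. \<integral>\<omega>. (norm (X i \<omega>))\<^sup>2 \<partial>M)"
  using assms
proof (induction I)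
  case (insert i I)
  have "(\<integral>\<omega>. inner (X i \<omega>) (\<Sum>j\<in>I. X j \<omega>) \<partial>M) = (\<integral>\<omega>. (\<Sum>j\<in>I. inner (X i \<omega>) (X j \<omega>)) \<partial>M)"
    by (simp add: inner_sum_right)
  also have "\<dots> = (\<Sum>j\<in>I. \<integral>\<omega>. inner (X i \<omega>) (X j \<omega>) \<partial>M)"
    using insert.prems by (intro Bochner_Integration.integral_sum square_integrable_inner) auto
  also have "\<dots> = 0" using insert.hyps insert.prems by (intro sum.neutral) auto
  finally have "(\<integral>\<omega>. inner (X i \<omega>) (\<Sum>j\<in>I. X j \<omega>) \<partial>M) = 0" .
  then have "(\<integral>\<omega>. (norm (X i \<omega> + (\<Sum>j\<in>I. X j \<omega>)))\<^sup>2 \<partial>M)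
      = (\<integral>\<omega>. (norm (X i \<omega>))\<^sup>2 \<partial>M) + (\<integral>\<omega>. (norm (\<Sum>j\<in>I. X j \<omega>))\<^sup>2 \<partial>M)"
    using insert.prems by (intro integral_norm_square_add_orthogonal square_integrable_sum) auto
  then show ?case using insert by simp
qed simp

section \<open>Generated sigma-algebras and integration over an independent variable\<close>

text \<open>The sigma-algebra generated by the \<open>X i\<close> with \<open>i\<close> in
  \<open>A\<close>. Pulling back a product sigma-algebra matches the form of
  \<open>indep_var_restrict\<close>; \<open>restrict\<close> makes the values extensional, as the
  space of \<open>PiM\<close> requires.\<close>

definition generated_algebra :: "'a measure \<Rightarrow> ('i \<Rightarrow> 'a \<Rightarrow> 'b::topological_space) \<Rightarrow> 'i set \<Rightarrow> 'a measure" where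
  "generated_algebra M X A = vimage_algebra (space M) (\<lambda>\<omega>. restrict (\<lambda>i. X i \<omega>) A) (PiM A (\<lambda>_. borel))"

lemma space_generated_algebra [simp]: "space (generated_algebra M X A) = space M"
  by (simp add: generated_algebra_def)

lemma measurable_generated_algebra_component:
  assumes "i \<in> A"
  shows "X i \<in> generated_algebra M X A \<rightarrow>\<^sub>M borel"
proof -
  have "(\<lambda>\<omega>. restrict (\<lambda>i. X i \<omega>) A) \<in> generated_algebra M X A \<rightarrow>\<^sub>M PiM A (\<lambda>_. borel)"
    unfolding generated_algebra_def by (rule measurable_vimage_algebra1) (auto simp: space_PiM)
  then have "(\<lambda>\<omega>. restrict (\<lambda>i. X i \<omega>) A i) \<in> generated_algebra M X A \<rightarrow>\<^sub>M borel"
    using assms by measurable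
  then show ?thesis using assms by simp
qed

context prob_space
begin

text \<open>The generated sigma-algebra lies inside that of \<open>M\<close>, which is expressed as
  measurability of the identity.\<close>

lemma measurable_generated_algebra_imp:
  assumes "indep_vars (\<lambda>_. borel) X UNIV" and W: "W \<in> generated_algebra M X A \<rightarrow>\<^sub>M N"
  shows "W \<in> M \<rightarrow>\<^sub>M N"
proof -
  have "(\<lambda>\<omega>. \<omega>) \<in> M \<rightarrow>\<^sub>M generated_algebra M X A"
    unfolding generated_algebra_def
  proof (rule measurable_vimage_algebra2)
    show "(\<lambda>\<omega>. restrict (\<lambda>i. X i \<omega>) A) \<in> M \<rightarrow>\<^sub>M PiM A (\<lambda>_. borel)"
      using assms(1) by (intro measurable_restrict) (auto simp: indep_vars_def)
  qed auto
  from measurable_compose[OF this W] show ?thesis by simp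
qed

text \<open>The library's \<open>indep_var\<close> forces both random variables to have the same type;
  independence of \<open>W\<close> and \<open>X j\<close> is therefore expressed by their joint distribution.\<close>

lemma distr_pair_generated_algebra:
  fixes X :: "'i \<Rightarrow> 'a \<Rightarrow> 'b::topological_space" and W :: "'a \<Rightarrow> 'c"
  assumes X: "indep_vars (\<lambda>_. borel) X UNIV" and "j \<notin> A"
    and W: "W \<in> generated_algebra M X A \<rightarrow>\<^sub>M N"
  shows "distr M N W \<Otimes>\<^sub>M distr M borel (X j) = distr M (N \<Otimes>\<^sub>M borel) (\<lambda>\<omega>. (W \<omega>, X j \<omega>))"
proof -
  have Xj [measurable]: "X j \<in> borel_measurable M" using X by (auto simp: indep_vars_def)
  have WM [measurable]: "W \<in> M \<rightarrow>\<^sub>M N" by (rule measurable_generated_algebra_imp[OF X W])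
  have "indep_var (PiM A (\<lambda>_. borel)) (\<lambda>\<omega>. restrict (\<lambda>i. X i \<omega>) A)
      (PiM {j} (\<lambda>_. borel)) (\<lambda>\<omega>. restrict (\<lambda>i. X i \<omega>) {j})"
    using X assms(2) by (intro indep_var_restrict) auto
  then have ind: "indep_set (sets (generated_algebra M X A)) (sets (generated_algebra M X {j}))"
    unfolding indep_var_eq by (simp add: generated_algebra_def sets_vimage_algebra)
  interpret P: prob_space "distr M N W" by (rule prob_space_distr) fact
  interpret Q: prob_space "distr M borel (X j)" by (rule prob_space_distr) fact
  show ?thesis
  \<comment> \<open>It suffices to compare both measures on rectangles, where the claim is the
    independence of the events \<open>W \<in> C\<close> and \<open>X j \<in> B\<close>.\<close>
  proof (rule pair_measure_eqI)
    fix C B assume "C \<in> sets (distr M N W)" "B \<in> sets (distr M borel (X j))"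
    then have [measurable]: "C \<in> sets N" "B \<in> sets borel" by auto
    have "prob ((W -` C \<inter> space M) \<inter> (X j -` B \<inter> space M)) = prob (W -` C \<inter> space M) * prob (X j -` B \<inter> space M)"
      using indep_setD[OF ind, of "W -` C \<inter> space M" "X j -` B \<inter> space M"]
        measurable_sets[OF W, of C] measurable_sets[OF measurable_generated_algebra_component[of j "{j}" X M], of B]
      by simp
    moreover have "(\<lambda>\<omega>. (W \<omega>, X j \<omega>)) -` (C \<times> B) \<inter> space M = (W -` C \<inter> space M) \<inter> (X j -` B \<inter> space M)"
      by auto
    ultimately show "emeasure (distr M N W) C * emeasure (distr M borel (X j)) B
        = emeasure (distr M (N \<Otimes>\<^sub>M borel) (\<lambda>\<omega>. (W \<omega>, X j \<omega>))) (C \<times> B)"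
      by (simp add: emeasure_distr emeasure_eq_measure ennreal_mult'')
  qed (auto intro: P.sigma_finite_measure_axioms Q.sigma_finite_measure_axioms)
qed

text \<open>The conditional expectation of \<open>G (W, V)\<close> given \<open>(W, Y)\<close> is obtained by averaging over \<open>V\<close> alone.\<close>

lemma integral_inner_indep:
  fixes G :: "('b::euclidean_space) \<times> ('c::euclidean_space) \<Rightarrow> 'd::euclidean_space"
  assumes WY [measurable]: "(\<lambda>\<omega>. (W \<omega>, Y \<omega>)) \<in> M \<rightarrow>\<^sub>M borel \<Otimes>\<^sub>M borel"
    and V [measurable]: "V \<in> borel_measurable M"
    and joint: "distr M (borel \<Otimes>\<^sub>M borel) (\<lambda>\<omega>. (W \<omega>, Y \<omega>)) \<Otimes>\<^sub>M distr M borel V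
      = distr M ((borel \<Otimes>\<^sub>M borel) \<Otimes>\<^sub>M borel) (\<lambda>\<omega>. ((W \<omega>, Y \<omega>), V \<omega>))"
    and G [measurable]: "G \<in> borel \<Otimes>\<^sub>M borel \<rightarrow>\<^sub>M borel"
    and int: "\<And>\<theta>. integrable M (\<lambda>\<omega>. G (\<theta>, V \<omega>))"
    and Y: "square_integrable M Y" and GV: "square_integrable M (\<lambda>\<omega>. G (W \<omega>, V \<omega>))"
  shows "(\<integral>\<omega>. inner (Y \<omega>) (G (W \<omega>, V \<omega>)) \<partial>M)
    = (\<integral>\<omega>. inner (Y \<omega>) (\<integral>\<omega>'. G (W \<omega>, V \<omega>') \<partial>M) \<partial>M)"
proof -
  have [measurable]: "W \<in> borel_measurable M" "Y \<in> borel_measurable M"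
    using measurable_compose[OF WY measurable_fst] measurable_compose[OF WY measurable_snd] by simp_all
  interpret P: prob_space "distr M (borel \<Otimes>\<^sub>M borel) (\<lambda>\<omega>. (W \<omega>, Y \<omega>))" by (rule prob_space_distr) fact
  interpret Q: prob_space "distr M borel V" by (rule prob_space_distr) fact
  interpret PQ: pair_prob_space "distr M (borel \<Otimes>\<^sub>M borel) (\<lambda>\<omega>. (W \<omega>, Y \<omega>))" "distr M borel V" ..
  define f where "f = (\<lambda>(w :: 'b \<times> 'd, v). inner (snd w) (G (fst w, v)))"
  have f [measurable]: "f \<in> borel_measurable ((borel \<Otimes>\<^sub>M borel) \<Otimes>\<^sub>M borel)"
    unfolding f_def by measurable
  have "integrable M (\<lambda>\<omega>. f ((W \<omega>, Y \<omega>), V \<omega>))"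
    using square_integrable_inner[OF Y GV] by (simp add: f_def)
  \<comment> \<open>Fubini needs integrability under the product measure; \<open>joint\<close>
    transports it from \<open>M\<close>.\<close>
  then have fint: "integrable (distr M (borel \<Otimes>\<^sub>M borel) (\<lambda>\<omega>. (W \<omega>, Y \<omega>)) \<Otimes>\<^sub>M distr M borel V) f"
    unfolding joint by (subst integrable_distr_eq) auto
  have inner: "(\<integral>v. f (w, v) \<partial>distr M borel V) = inner (snd w) (\<integral>\<omega>. G (fst w, V \<omega>) \<partial>M)" for w
    using int[of "fst w"] by (subst integral_distr) (auto simp: f_def)
  have h [measurable]: "(\<lambda>w. inner (snd w) (\<integral>\<omega>. G (fst w, V \<omega>) \<partial>M)) \<in> borel_measurable (borel \<Otimes>\<^sub>M borel)"
    by measurable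
  have "(\<integral>\<omega>. inner (Y \<omega>) (G (W \<omega>, V \<omega>)) \<partial>M) = (\<integral>\<omega>. f ((W \<omega>, Y \<omega>), V \<omega>) \<partial>M)" by (simp add: f_def)
  also have "\<dots> = (\<integral>p. f p \<partial>(distr M (borel \<Otimes>\<^sub>M borel) (\<lambda>\<omega>. (W \<omega>, Y \<omega>)) \<Otimes>\<^sub>M distr M borel V))"
    unfolding joint by (subst integral_distr) auto
  also have "\<dots> = (\<integral>w. (\<integral>v. f (w, v) \<partial>distr M borel V) \<partial>distr M (borel \<Otimes>\<^sub>M borel) (\<lambda>\<omega>. (W \<omega>, Y \<omega>)))"
    by (rule PQ.integral_fst'[OF fint, symmetric])
  also have "\<dots> = (\<integral>\<omega>. inner (Y \<omega>) (\<integral>\<omega>'. G (W \<omega>, V \<omega>') \<partial>M) \<partial>M)"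
    unfolding inner by (subst integral_distr) auto
  finally show ?thesis .
qed

end

subsection \<open>The momentum method\<close>

locale momentum_sgd = prob_space M for M :: "'a measure" +
  fixes U :: "nat \<Rightarrow> nat \<Rightarrow> 'a \<Rightarrow> real ^ 'e"
    and G :: "(real ^ 'd) \<times> (real ^ 'e) \<Rightarrow> real ^ 'd"
    and \<xi> \<theta>star :: "real ^ 'd"
    and \<alpha> c \<Gamma> l :: real
    and \<Theta> m :: "nat \<Rightarrow> nat \<Rightarrow> 'a \<Rightarrow> real ^ 'd"
  assumes indep: "indep_vars (\<lambda>_. borel) (\<lambda>(n, k). U n k) UNIV"
    and ident: "\<And>n k n' k'. distr M borel (U n k) = distr M borel (U n' k')"
    and G_measurable [measurable]: "G \<in> borel \<Otimes>\<^sub>M borel \<rightarrow>\<^sub>M borel"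
    and \<alpha>: "0 \<le> \<alpha>" "\<alpha> < 1" and c: "0 < c" and \<Gamma>: "0 < \<Gamma>" and l: "0 < l" "l < 1"
    and \<Theta>_0: "\<And>J \<omega>. J \<ge> 1 \<Longrightarrow> \<omega> \<in> space M \<Longrightarrow> \<Theta> J 0 \<omega> = \<xi>"
    and m_0: "\<And>J \<omega>. J \<ge> 1 \<Longrightarrow> \<omega> \<in> space M \<Longrightarrow> m J 0 \<omega> = 0"
    and \<Theta>_step: "\<And>J n \<omega>. J \<ge> 1 \<Longrightarrow> n \<ge> 1 \<Longrightarrow> \<omega> \<in> space M \<Longrightarrow>
           \<Theta> J n \<omega> = \<Theta> J (n - 1) \<omega> - (\<Gamma> * real n powr (- l)) *\<^sub>R m J n \<omega>"
    and m_step: "\<And>J n \<omega>. J \<ge> 1 \<Longrightarrow> n \<ge> 1 \<Longrightarrow> \<omega> \<in> space M \<Longrightarrow>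
           m J n \<omega> = \<alpha> *\<^sub>R m J (n - 1) \<omega>
             + (1 - \<alpha>) *\<^sub>R ((1 / real J) *\<^sub>R (\<Sum>j = 1..J. G (\<Theta> J (n - 1) \<omega>, U n j \<omega>)))"
    and moments: "\<And>\<theta>. (SUP (J, n) \<in> {1..} \<times> {1..}.
           \<integral>\<^sup>+ \<omega>. ennreal (norm (G (\<theta>, U 0 1 \<omega>)) + (norm (G (\<Theta> J (n - 1) \<omega>, U 0 1 \<omega>)))\<^sup>2) \<partial>M) < \<infinity>"
    and coercive: "\<And>\<theta>. inner (\<theta> - \<theta>star) (\<integral>\<omega>. G (\<theta>, U 1 1 \<omega>) \<partial>M)
           \<ge> c * max ((norm (\<theta> - \<theta>star))\<^sup>2) ((norm (\<integral>\<omega>. G (\<theta>, U 1 1 \<omega>) \<partial>M))\<^sup>2)"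
begin

text \<open>Since \<open>0 powr (- l) = 0\<close>, the value at index 0 is 0, so the sequence
  decreases only from index 1 on. Hence the side conditions \<open>1 \<le> n\<close> below.\<close>

definition \<gamma> :: "nat \<Rightarrow> real" where "\<gamma> n = \<Gamma> * real n powr (- l)"

definition g :: "real ^ 'd \<Rightarrow> real ^ 'd" where "g \<theta> = (\<integral>\<omega>. G (\<theta>, U 1 1 \<omega>) \<partial>M)"

definition F :: "(nat \<times> nat) set \<Rightarrow> 'a measure" where "F A = generated_algebra M (\<lambda>(n, k). U n k) A"

text \<open>The rows consumed by the first \<open>n\<close> steps, with all columns so that one set
  serves every batch size. Row 0 is left out, so \<open>U 0 1\<close> is independent of every
  iterate.\<close>

definition past :: "nat \<Rightarrow> (nat \<times> nat) set" where "past n = {1..n} \<times> UNIV"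

definition noise :: "nat \<Rightarrow> nat \<Rightarrow> nat \<Rightarrow> 'a \<Rightarrow> real ^ 'd" where
  "noise J n j \<omega> = G (\<Theta> J n \<omega>, U (Suc n) j \<omega>) - g (\<Theta> J n \<omega>)"

definition mean_noise :: "nat \<Rightarrow> nat \<Rightarrow> 'a \<Rightarrow> real ^ 'd" where
  "mean_noise J n \<omega> = (1 / real J) *\<^sub>R (\<Sum>j = 1..J. noise J n j \<omega>)"

text \<open>A bound, uniform in \<open>J\<close> and \<open>n\<close>, for the second moment of
  \<open>G\<close> at the iterates. The point \<open>0\<close> in the first summand is an arbitrary
  choice of \<open>\<theta>\<close> in the moment hypothesis.\<close>

definition K :: real where
  "K = enn2real (SUP (J, n) \<in> {1..} \<times> {1..}.
     \<integral>\<^sup>+ \<omega>. ennreal (norm (G (0, U 0 1 \<omega>)) + (norm (G (\<Theta> J (n - 1) \<omega>, U 0 1 \<omega>)))\<^sup>2) \<partial>M)"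

section \<open>Direct consequences of the hypotheses\<close>

lemma K_nonneg: "0 \<le> K"
  by (simp add: K_def)

lemma \<gamma>_pos: "1 \<le> n \<Longrightarrow> 0 < \<gamma> n"
  using \<Gamma> by (simp add: \<gamma>_def)

lemma \<gamma>_nonneg: "0 \<le> \<gamma> n"
  using \<Gamma> by (simp add: \<gamma>_def)

lemma \<gamma>_antimono: "1 \<le> n \<Longrightarrow> n \<le> k \<Longrightarrow> \<gamma> k \<le> \<gamma> n"
  unfolding \<gamma>_def using \<Gamma> l by (intro mult_left_mono powr_mono2') auto

lemma \<gamma>_le: "\<gamma> n \<le> \<Gamma>"
proof (cases "n = 0")
  case False
  then show ?thesis using \<gamma>_antimono[of 1 n] by (simp add: \<gamma>_def)
qed (use \<Gamma> in \<open>simp add: \<gamma>_def\<close>)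

lemma U_measurable [measurable]: "U n k \<in> borel_measurable M"
proof -
  have "(\<lambda>(n, k). U n k) (n, k) \<in> borel_measurable M"
    using indep unfolding indep_vars_def by blast
  then show ?thesis by simp
qed

lemma g_measurable [measurable]: "g \<in> borel_measurable borel"
  unfolding g_def by measurable

lemma nn_integral_le_K:
  assumes "1 \<le> J"
  shows "(\<integral>\<^sup>+ \<omega>. ennreal (norm (G (0, U 0 1 \<omega>)) + (norm (G (\<Theta> J n \<omega>, U 0 1 \<omega>)))\<^sup>2) \<partial>M) \<le> ennreal K"
proof -
  have "(\<integral>\<^sup>+ \<omega>. ennreal (norm (G (0, U 0 1 \<omega>)) + (norm (G (\<Theta> J n \<omega>, U 0 1 \<omega>)))\<^sup>2) \<partial>M)
      \<le> (SUP (J, n) \<in> {1..} \<times> {1..}.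
     \<integral>\<^sup>+ \<omega>. ennreal (norm (G (0, U 0 1 \<omega>)) + (norm (G (\<Theta> J (n - 1) \<omega>, U 0 1 \<omega>)))\<^sup>2) \<partial>M)"
    \<comment> \<open>The supremum is over iterates with index \<open>n - 1\<close>, so the iterate
      \<open>n\<close> is found at \<open>Suc n\<close>.\<close>
    using assms by (intro SUP_upper2[of "(J, Suc n)"]) auto
  also have "\<dots> = ennreal K" unfolding K_def using moments[of 0] by simp
  finally show ?thesis .
qed

text \<open>The first summand of the moment hypothesis gives integrability for \<open>U 0 1\<close>;
  equality in law carries it, and the value of the mean, to all indices.\<close>

lemma G_integrable: "integrable M (\<lambda>\<omega>. G (\<theta>, U n k \<omega>))"
  and integral_G: "(\<integral>\<omega>. G (\<theta>, U n k \<omega>) \<partial>M) = g \<theta>"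
proof -
  have [measurable]: "(\<lambda>u. G (\<theta>, u)) \<in> borel_measurable borel" by measurable
  have "(\<integral>\<^sup>+ \<omega>. ennreal (norm (G (\<theta>, U 0 1 \<omega>))) \<partial>M)
      \<le> (\<integral>\<^sup>+ \<omega>. ennreal (norm (G (\<theta>, U 0 1 \<omega>)) + (norm (G (\<Theta> 1 (1 - 1) \<omega>, U 0 1 \<omega>)))\<^sup>2) \<partial>M)"
    by (intro nn_integral_mono ennreal_leI) auto
  also have "\<dots> \<le> (SUP (J, n) \<in> {1..} \<times> {1..}.
     \<integral>\<^sup>+ \<omega>. ennreal (norm (G (\<theta>, U 0 1 \<omega>)) + (norm (G (\<Theta> J (n - 1) \<omega>, U 0 1 \<omega>)))\<^sup>2) \<partial>M)"
    by (intro SUP_upper2[of "(1, 1)"]) auto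
  also have "\<dots> < \<infinity>" by (rule moments)
  finally have "integrable M (\<lambda>\<omega>. G (\<theta>, U 0 1 \<omega>))" by (intro integrableI_bounded) auto
  then have "integrable (distr M borel (U 0 1)) (\<lambda>u. G (\<theta>, u))" by (subst integrable_distr_eq) auto
  then have "integrable (distr M borel (U n k)) (\<lambda>u. G (\<theta>, u))" unfolding ident[of n k 0 1] .
  then show "integrable M (\<lambda>\<omega>. G (\<theta>, U n k \<omega>))" by (subst (asm) integrable_distr_eq) auto
  have "(\<integral>\<omega>. G (\<theta>, U n k \<omega>) \<partial>M) = (\<integral>u. G (\<theta>, u) \<partial>distr M borel (U n k))"
    by (subst integral_distr) auto
  also have "\<dots> = (\<integral>u. G (\<theta>, u) \<partial>distr M borel (U 1 1))" unfolding ident[of n k 1 1] ..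
  also have "\<dots> = g \<theta>" unfolding g_def by (subst integral_distr) auto
  finally show "(\<integral>\<omega>. G (\<theta>, U n k \<omega>) \<partial>M) = g \<theta>" .
qed

lemma g_coercive:
  "c * (norm (\<theta> - \<theta>star))\<^sup>2 \<le> inner (\<theta> - \<theta>star) (g \<theta>)"
  "c * (norm (g \<theta>))\<^sup>2 \<le> inner (\<theta> - \<theta>star) (g \<theta>)"
  using coercive[of \<theta>, folded g_def] c
  by (auto intro: order_trans[rotated] mult_left_mono)

text \<open>Cauchy-Schwarz in the second coercivity bound, then cancelling one factor
  \<open>norm (g \<theta>)\<close>. This linear growth makes \<open>g\<close> square-integrable
  along the iterates.\<close>

lemma norm_g_le: "norm (g \<theta>) \<le> 1 / c * norm (\<theta> - \<theta>star)"
proof (cases "g \<theta> = 0")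
  case False
  have "c * norm (g \<theta>) * norm (g \<theta>) \<le> norm (\<theta> - \<theta>star) * norm (g \<theta>)"
    using g_coercive(2)[of \<theta>] norm_cauchy_schwarz[of "\<theta> - \<theta>star" "g \<theta>"] by (simp add: power2_eq_square)
  then show ?thesis using False c by (simp add: field_simps)
qed (use c in simp)

lemma Suc_steps:
  assumes "1 \<le> J" "\<omega> \<in> space M"
  shows "\<Theta> J (Suc n) \<omega> = \<Theta> J n \<omega> - \<gamma> (Suc n) *\<^sub>R m J (Suc n) \<omega>"
    and "m J (Suc n) \<omega> = \<alpha> *\<^sub>R m J n \<omega>
      + (1 - \<alpha>) *\<^sub>R ((1 / real J) *\<^sub>R (\<Sum>j = 1..J. G (\<Theta> J n \<omega>, U (Suc n) j \<omega>)))"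
  using \<Theta>_step[of J "Suc n" \<omega>] m_step[of J "Suc n" \<omega>] assms by (auto simp: \<gamma>_def)

section \<open>Adaptedness and square integrability of the process\<close>

lemma U_adapted: "(n, k) \<in> A \<Longrightarrow> U n k \<in> F A \<rightarrow>\<^sub>M borel"
  unfolding F_def using measurable_generated_algebra_component[of "(n, k)" A "\<lambda>(n, k). U n k" M] by simp

lemma adapted_measurable: "X \<in> F A \<rightarrow>\<^sub>M N \<Longrightarrow> X \<in> M \<rightarrow>\<^sub>M N"
  unfolding F_def by (rule measurable_generated_algebra_imp[OF indep])

text \<open>Induction along the recursion. The set \<open>A\<close> may exceed \<open>past n\<close>
  so that one further sample of the current row can be included when noise terms are compared with
  each other.\<close>

lemma adapted:
  assumes J: "1 \<le> J" and "past n \<subseteq> A"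
  shows "\<Theta> J n \<in> F A \<rightarrow>\<^sub>M borel" and "m J n \<in> F A \<rightarrow>\<^sub>M borel"
proof -
  have sp: "space (F A) = space M" by (simp add: F_def)
  have "\<Theta> J n \<in> F A \<rightarrow>\<^sub>M borel \<and> m J n \<in> F A \<rightarrow>\<^sub>M borel"
    using assms(2)
  proof (induction n)
    case 0
    \<comment> \<open>The defining equations hold on \<open>space M\<close> only, so measurability
      is transferred by congruence on that space.\<close>
    have "\<Theta> J 0 \<in> F A \<rightarrow>\<^sub>M borel \<longleftrightarrow> (\<lambda>_. \<xi>) \<in> F A \<rightarrow>\<^sub>M borel"
      by (rule measurable_cong) (simp add: sp \<Theta>_0[OF J])
    moreover have "m J 0 \<in> F A \<rightarrow>\<^sub>M borel \<longleftrightarrow> (\<lambda>_. 0 :: real ^ 'd) \<in> F A \<rightarrow>\<^sub>M borel"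
      by (rule measurable_cong) (simp add: sp m_0[OF J])
    ultimately show ?case by simp
  next
    case (Suc n)
    have "past n \<subseteq> A" using Suc.prems by (auto simp: past_def)
    with Suc.IH have [measurable]: "\<Theta> J n \<in> F A \<rightarrow>\<^sub>M borel" "m J n \<in> F A \<rightarrow>\<^sub>M borel" by auto
    have [measurable]: "U (Suc n) j \<in> F A \<rightarrow>\<^sub>M borel" for j
      using Suc.prems by (intro U_adapted) (auto simp: past_def)
    have "m J (Suc n) \<in> F A \<rightarrow>\<^sub>M borel \<longleftrightarrow> (\<lambda>\<omega>. \<alpha> *\<^sub>R m J n \<omega>
      + (1 - \<alpha>) *\<^sub>R ((1 / real J) *\<^sub>R (\<Sum>j = 1..J. G (\<Theta> J n \<omega>, U (Suc n) j \<omega>)))) \<in> F A \<rightarrow>\<^sub>M borel"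
      by (rule measurable_cong) (simp add: sp Suc_steps(2)[OF J])
    then have [measurable]: "m J (Suc n) \<in> F A \<rightarrow>\<^sub>M borel" by simp
    have "\<Theta> J (Suc n) \<in> F A \<rightarrow>\<^sub>M borel \<longleftrightarrow> (\<lambda>\<omega>. \<Theta> J n \<omega> - \<gamma> (Suc n) *\<^sub>R m J (Suc n) \<omega>) \<in> F A \<rightarrow>\<^sub>M borel"
      by (rule measurable_cong) (simp add: sp Suc_steps(1)[OF J])
    then show ?case by simp
  qed
  then show "\<Theta> J n \<in> F A \<rightarrow>\<^sub>M borel" "m J n \<in> F A \<rightarrow>\<^sub>M borel" by auto
qed

lemma process_measurable:
  assumes "1 \<le> J"
  shows "\<Theta> J n \<in> borel_measurable M" and "m J n \<in> borel_measurable M"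
  using adapted[OF assms order_refl] by (auto intro: adapted_measurable)

lemma distr_pair_adapted:
  assumes "X \<in> F A \<rightarrow>\<^sub>M N" "(n, k) \<notin> A"
  shows "distr M N X \<Otimes>\<^sub>M distr M borel (U n k) = distr M (N \<Otimes>\<^sub>M borel) (\<lambda>\<omega>. (X \<omega>, U n k \<omega>))"
  using distr_pair_generated_algebra[OF indep assms(2) assms(1)[unfolded F_def]] by simp

text \<open>The iterate is independent both of \<open>U (Suc n) j\<close> and of
  \<open>U 0 1\<close>, and these have the same law. Its pairs with them therefore have the same
  joint law, and the moment hypothesis for \<open>U 0 1\<close> applies to the sample actually
  used.\<close>

lemma square_integrable_sample:
  assumes J: "1 \<le> J"
  shows "square_integrable M (\<lambda>\<omega>. G (\<Theta> J n \<omega>, U (Suc n) j \<omega>))"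
    and "(\<integral>\<omega>. (norm (G (\<Theta> J n \<omega>, U (Suc n) j \<omega>)))\<^sup>2 \<partial>M) \<le> K"
proof -
  note [measurable] = process_measurable[OF J]
  have "distr M (borel \<Otimes>\<^sub>M borel) (\<lambda>\<omega>. (\<Theta> J n \<omega>, U (Suc n) j \<omega>)) = distr M (borel \<Otimes>\<^sub>M borel) (\<lambda>\<omega>. (\<Theta> J n \<omega>, U 0 1 \<omega>))"
    using distr_pair_adapted[OF adapted(1)[OF J order_refl], of "Suc n" j n]
      distr_pair_adapted[OF adapted(1)[OF J order_refl], of 0 1 n] ident[of "Suc n" j 0 1]
    by (simp add: past_def)
  then have "(\<integral>\<^sup>+p. ennreal ((norm (G p))\<^sup>2) \<partial>distr M (borel \<Otimes>\<^sub>M borel) (\<lambda>\<omega>. (\<Theta> J n \<omega>, U (Suc n) j \<omega>)))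
      = (\<integral>\<^sup>+p. ennreal ((norm (G p))\<^sup>2) \<partial>distr M (borel \<Otimes>\<^sub>M borel) (\<lambda>\<omega>. (\<Theta> J n \<omega>, U 0 1 \<omega>)))"
    by simp
  then have "(\<integral>\<^sup>+\<omega>. ennreal ((norm (G (\<Theta> J n \<omega>, U (Suc n) j \<omega>)))\<^sup>2) \<partial>M)
      = (\<integral>\<^sup>+\<omega>. ennreal ((norm (G (\<Theta> J n \<omega>, U 0 1 \<omega>)))\<^sup>2) \<partial>M)"
    by (simp add: nn_integral_distr)
  also have "\<dots> \<le> (\<integral>\<^sup>+ \<omega>. ennreal (norm (G (0, U 0 1 \<omega>)) + (norm (G (\<Theta> J n \<omega>, U 0 1 \<omega>)))\<^sup>2) \<partial>M)"
    by (intro nn_integral_mono ennreal_leI) auto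
  also have "\<dots> \<le> ennreal K" by (rule nn_integral_le_K[OF J])
  finally have le: "(\<integral>\<^sup>+\<omega>. ennreal ((norm (G (\<Theta> J n \<omega>, U (Suc n) j \<omega>)))\<^sup>2) \<partial>M) \<le> ennreal K" .
  have int: "integrable M (\<lambda>\<omega>. (norm (G (\<Theta> J n \<omega>, U (Suc n) j \<omega>)))\<^sup>2)"
    by (rule integrableI_nonneg) (use le in \<open>auto simp: less_top[symmetric] top_unique\<close>)
  then show "square_integrable M (\<lambda>\<omega>. G (\<Theta> J n \<omega>, U (Suc n) j \<omega>))" by (simp add: square_integrable_def)
  show "(\<integral>\<omega>. (norm (G (\<Theta> J n \<omega>, U (Suc n) j \<omega>)))\<^sup>2 \<partial>M) \<le> K"
    using le K_nonneg by (subst (asm) nn_integral_eq_integral[OF int]) auto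
qed

lemma square_integrable_cong:
  assumes "\<And>\<omega>. \<omega> \<in> space M \<Longrightarrow> X \<omega> = Y \<omega>"
  shows "square_integrable M X \<longleftrightarrow> square_integrable M Y"
  unfolding square_integrable_def using assms
  by (metis (no_types, lifting) Bochner_Integration.integrable_cong measurable_cong)

lemma square_integrable_process:
  assumes J: "1 \<le> J"
  shows "square_integrable M (\<Theta> J n)" and "square_integrable M (m J n)"
proof -
  have const: "square_integrable M (\<lambda>_. v)" for v :: "real ^ 'd" by (simp add: square_integrable_def)
  have "square_integrable M (\<Theta> J n) \<and> square_integrable M (m J n)"
  proof (induction n)
    case 0
    then show ?case
      using square_integrable_cong[of "\<Theta> J 0" "\<lambda>_. \<xi>"] square_integrable_cong[of "m J 0" "\<lambda>_. 0"]
        \<Theta>_0[OF J] m_0[OF J] const by auto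
  next
    case (Suc n)
    have "square_integrable M (\<lambda>\<omega>. \<alpha> *\<^sub>R m J n \<omega>
      + (1 - \<alpha>) *\<^sub>R ((1 / real J) *\<^sub>R (\<Sum>j = 1..J. G (\<Theta> J n \<omega>, U (Suc n) j \<omega>))))"
      using Suc square_integrable_sample(1)[OF J]
      by (intro square_integrable_add square_integrable_scaleR square_integrable_sum) auto
    then have mS: "square_integrable M (m J (Suc n))"
      using square_integrable_cong[OF Suc_steps(2)[OF J]] by simp
    then have "square_integrable M (\<lambda>\<omega>. \<Theta> J n \<omega> - \<gamma> (Suc n) *\<^sub>R m J (Suc n) \<omega>)"
      using Suc by (intro square_integrable_diff square_integrable_scaleR) auto
    then have "square_integrable M (\<Theta> J (Suc n))"
      using square_integrable_cong[OF Suc_steps(1)[OF J]] by simp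
    with mS show ?case by simp
  qed
  then show "square_integrable M (\<Theta> J n)" "square_integrable M (m J n)" by auto
qed

lemma square_integrable_error:
  assumes "1 \<le> J"
  shows "square_integrable M (\<lambda>\<omega>. \<Theta> J n \<omega> - \<theta>star)"
  using square_integrable_process(1)[OF assms]
  by (rule square_integrable_diff) (simp add: square_integrable_def)

lemma square_integrable_g:
  assumes "1 \<le> J"
  shows "square_integrable M (\<lambda>\<omega>. g (\<Theta> J n \<omega>))"
proof (rule square_integrable_bound[OF square_integrable_error[OF assms] _ norm_g_le])
  show "(\<lambda>\<omega>. g (\<Theta> J n \<omega>)) \<in> borel_measurable M" using process_measurable[OF assms] by measurable
qed

section \<open>Orthogonality and size of the gradient noise\<close>

lemma square_integrable_noise:
  assumes "1 \<le> J"
  shows "square_integrable M (noise J n j)" and "square_integrable M (mean_noise J n)"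
proof -
  show *: "square_integrable M (noise J n j)" for j
    unfolding noise_def using square_integrable_sample(1) square_integrable_g assms
    by (intro square_integrable_diff) auto
  show "square_integrable M (mean_noise J n)"
    unfolding mean_noise_def using * by (intro square_integrable_scaleR square_integrable_sum) auto
qed

text \<open>The conditional mean of the noise given \<open>F A\<close> is zero, stated through test
  functions: averaging \<open>G\<close> over the fresh sample leaves \<open>g\<close>. The set
  \<open>A\<close> is \<open>past n\<close> for the dynamics and contains one more sample in the
  pairwise comparison.\<close>

lemma noise_orthogonal:
  assumes J: "1 \<le> J" and A: "past n \<subseteq> A" "(Suc n, j) \<notin> A"
    and Y: "Y \<in> F A \<rightarrow>\<^sub>M borel" "square_integrable M Y"
  shows "(\<integral>\<omega>. inner (Y \<omega>) (noise J n j \<omega>) \<partial>M) = 0"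
proof -
  have [measurable]: "\<Theta> J n \<in> F A \<rightarrow>\<^sub>M borel" "Y \<in> F A \<rightarrow>\<^sub>M borel" using adapted[OF J A(1)] Y by auto
  have W: "(\<lambda>\<omega>. (\<Theta> J n \<omega>, Y \<omega>)) \<in> F A \<rightarrow>\<^sub>M borel \<Otimes>\<^sub>M borel" by measurable
  have "(\<integral>\<omega>. inner (Y \<omega>) (G (\<Theta> J n \<omega>, U (Suc n) j \<omega>)) \<partial>M) = (\<integral>\<omega>. inner (Y \<omega>) (g (\<Theta> J n \<omega>)) \<partial>M)"
    using integral_inner_indep[OF adapted_measurable[OF W] U_measurable distr_pair_adapted[OF W A(2)]
        G_measurable G_integrable Y(2) square_integrable_sample(1)[OF J]]
    by (simp add: integral_G)
  then show ?thesis
    using square_integrable_inner[OF Y(2) square_integrable_sample(1)[OF J, of n j]]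
      square_integrable_inner[OF Y(2) square_integrable_g[OF J, of n]]
    by (simp add: noise_def inner_diff_right)
qed

lemma mean_noise_orthogonal:
  assumes J: "1 \<le> J" and Y: "Y \<in> F (past n) \<rightarrow>\<^sub>M borel" "square_integrable M Y"
  shows "(\<integral>\<omega>. inner (Y \<omega>) (mean_noise J n \<omega>) \<partial>M) = 0"
proof -
  have "(\<integral>\<omega>. inner (Y \<omega>) (mean_noise J n \<omega>) \<partial>M) = 1 / real J * (\<Sum>j = 1..J. \<integral>\<omega>. inner (Y \<omega>) (noise J n j \<omega>) \<partial>M)"
    using square_integrable_inner[OF Y(2) square_integrable_noise(1)[OF J]]
    by (simp add: mean_noise_def inner_sum_right)
  also have "\<dots> = 0" using noise_orthogonal[OF J order_refl _ Y] by (simp add: past_def)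
  finally show ?thesis .
qed

text \<open>The sample is the orthogonal sum of its conditional mean and the noise, so the noise has
  the smaller second moment.\<close>

lemma noise_second_moment:
  assumes J: "1 \<le> J"
  shows "(\<integral>\<omega>. (norm (noise J n j \<omega>))\<^sup>2 \<partial>M) \<le> K"
proof -
  have "(\<lambda>\<omega>. g (\<Theta> J n \<omega>)) \<in> F (past n) \<rightarrow>\<^sub>M borel"
    using adapted(1)[OF J order_refl] by measurable
  then have "(\<integral>\<omega>. inner (g (\<Theta> J n \<omega>)) (noise J n j \<omega>) \<partial>M) = 0"
    by (intro noise_orthogonal[OF J order_refl _ _ square_integrable_g[OF J]]) (auto simp: past_def)
  from integral_norm_square_add_orthogonal[OF square_integrable_g[OF J] square_integrable_noise(1)[OF J] this]
  have "(\<integral>\<omega>. (norm (G (\<Theta> J n \<omega>, U (Suc n) j \<omega>)))\<^sup>2 \<partial>M)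
      = (\<integral>\<omega>. (norm (g (\<Theta> J n \<omega>)))\<^sup>2 \<partial>M) + (\<integral>\<omega>. (norm (noise J n j \<omega>))\<^sup>2 \<partial>M)"
    by (simp add: noise_def)
  moreover have "0 \<le> (\<integral>\<omega>. (norm (g (\<Theta> J n \<omega>)))\<^sup>2 \<partial>M)" by simp
  ultimately show ?thesis using square_integrable_sample(2)[OF J, of n j] by linarith
qed

text \<open>Adding sample \<open>i\<close> to the past makes \<open>noise J n i\<close> a legitimate
  test function while sample \<open>j\<close> stays fresh.\<close>

lemma noise_pairwise_orthogonal:
  assumes J: "1 \<le> J" and "i \<noteq> j"
  shows "(\<integral>\<omega>. inner (noise J n i \<omega>) (noise J n j \<omega>) \<partial>M) = 0"
proof (rule noise_orthogonal[OF J, where A = "insert (Suc n, i) (past n)"])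
  have [measurable]: "\<Theta> J n \<in> F (insert (Suc n, i) (past n)) \<rightarrow>\<^sub>M borel"
    "U (Suc n) i \<in> F (insert (Suc n, i) (past n)) \<rightarrow>\<^sub>M borel"
    by (auto intro!: adapted[OF J] U_adapted)
  show "noise J n i \<in> F (insert (Suc n, i) (past n)) \<rightarrow>\<^sub>M borel"
    unfolding noise_def by measurable
qed (use assms square_integrable_noise(1) in \<open>auto simp: past_def\<close>)

text \<open>Orthogonality leaves \<open>J\<close> diagonal terms of size at most \<open>K\<close>,
  against the prefactor \<open>(1 / J)^2\<close>.\<close>

lemma mean_noise_second_moment:
  assumes J: "1 \<le> J"
  shows "(\<integral>\<omega>. (norm (mean_noise J n \<omega>))\<^sup>2 \<partial>M) \<le> K / real J"
proof -
  have "(\<integral>\<omega>. (norm (mean_noise J n \<omega>))\<^sup>2 \<partial>M) = (1 / real J)\<^sup>2 * (\<integral>\<omega>. (norm (\<Sum>j = 1..J. noise J n j \<omega>))\<^sup>2 \<partial>M)"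
    by (simp add: mean_noise_def power_mult_distrib power_divide)
  also have "(\<integral>\<omega>. (norm (\<Sum>j = 1..J. noise J n j \<omega>))\<^sup>2 \<partial>M) = (\<Sum>j = 1..J. \<integral>\<omega>. (norm (noise J n j \<omega>))\<^sup>2 \<partial>M)"
    using square_integrable_noise(1)[OF J] noise_pairwise_orthogonal[OF J]
    by (intro integral_norm_square_sum_orthogonal) auto
  also have "\<dots> \<le> real J * K"
    using sum_mono[of "{1..J}" "\<lambda>j. \<integral>\<omega>. (norm (noise J n j \<omega>))\<^sup>2 \<partial>M" "\<lambda>_. K"] noise_second_moment[OF J] by simp
  finally show ?thesis using J by (simp add: power2_eq_square mult_left_mono field_simps)
qed

text \<open>The cross term vanishes by orthogonality. Both the shifted error and the momentum have
  this form of a past-measurable part plus a multiple of the mean noise.\<close>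

lemma integral_norm_square_add_mean_noise:
  assumes J: "1 \<le> J" and Y: "Y \<in> F (past n) \<rightarrow>\<^sub>M borel" "square_integrable M Y"
  shows "(\<integral>\<omega>. (norm (Y \<omega> + r *\<^sub>R mean_noise J n \<omega>))\<^sup>2 \<partial>M)
    \<le> (\<integral>\<omega>. (norm (Y \<omega>))\<^sup>2 \<partial>M) + r\<^sup>2 * (K / real J)"
proof -
  have "(\<integral>\<omega>. (norm (Y \<omega> + r *\<^sub>R mean_noise J n \<omega>))\<^sup>2 \<partial>M)
      = (\<integral>\<omega>. (norm (Y \<omega>))\<^sup>2 \<partial>M) + (\<integral>\<omega>. (norm (r *\<^sub>R mean_noise J n \<omega>))\<^sup>2 \<partial>M)"
    using mean_noise_orthogonal[OF J Y]
    by (intro integral_norm_square_add_orthogonal Y square_integrable_scaleR square_integrable_noise(2) J) simp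
  also have "(\<integral>\<omega>. (norm (r *\<^sub>R mean_noise J n \<omega>))\<^sup>2 \<partial>M) = r\<^sup>2 * (\<integral>\<omega>. (norm (mean_noise J n \<omega>))\<^sup>2 \<partial>M)"
    by (simp add: power_mult_distrib)
  finally show ?thesis using mult_left_mono[OF mean_noise_second_moment[OF J, of n], of "r\<^sup>2"] by simp
qed

lemma m_noise_step:
  assumes J: "1 \<le> J" and "\<omega> \<in> space M"
  shows "m J (Suc n) \<omega> = (\<alpha> *\<^sub>R m J n \<omega> + (1 - \<alpha>) *\<^sub>R g (\<Theta> J n \<omega>)) + (1 - \<alpha>) *\<^sub>R mean_noise J n \<omega>"
proof -
  have eq: "(1 / real J) *\<^sub>R (\<Sum>j = 1..J. G (\<Theta> J n \<omega>, U (Suc n) j \<omega>)) = g (\<Theta> J n \<omega>) + mean_noise J n \<omega>"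
    using J by (simp add: mean_noise_def noise_def sum_subtractf scaleR_right_diff_distrib sum_constant_scaleR del: sum_constant)
  show ?thesis unfolding Suc_steps(2)[OF assms] eq by (simp add: scaleR_add_right add.assoc)
qed

section \<open>A priori bounds uniform in the batch size\<close>

text \<open>The new momentum is a convex combination of the old one and the batch average
  \<open>S\<close>; both have second moment at most \<open>K\<close>, so the bound
  propagates.\<close>

lemma momentum_second_moment:
  assumes J: "1 \<le> J"
  shows "(\<integral>\<omega>. (norm (m J n \<omega>))\<^sup>2 \<partial>M) \<le> K"
proof (induction n)
  case 0
  have "(\<integral>\<omega>. (norm (m J 0 \<omega>))\<^sup>2 \<partial>M) = (\<integral>\<omega>. 0 \<partial>M)"
    by (rule Bochner_Integration.integral_cong) (auto simp: m_0[OF J])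
  then show ?case using K_nonneg by simp
next
  case (Suc n)
  define S where "S \<omega> = (1 / real J) *\<^sub>R (\<Sum>j = 1..J. G (\<Theta> J n \<omega>, U (Suc n) j \<omega>))" for \<omega>
  have S: "square_integrable M S"
    unfolding S_def using square_integrable_sample(1)[OF J]
    by (intro square_integrable_scaleR square_integrable_sum) auto
  \<comment> \<open>Jensen's inequality for the batch average, obtained from the Cauchy-Schwarz
    inequality for sums.\<close>
  have norm_S: "(norm (S \<omega>))\<^sup>2 \<le> (1 / real J) * (\<Sum>j = 1..J. (norm (G (\<Theta> J n \<omega>, U (Suc n) j \<omega>)))\<^sup>2)" for \<omega>
  proof -
    have "norm (S \<omega>) \<le> 1 / real J * (\<Sum>j = 1..J. norm (G (\<Theta> J n \<omega>, U (Suc n) j \<omega>)))"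
      unfolding S_def by (simp add: norm_sum divide_right_mono)
    then have "(norm (S \<omega>))\<^sup>2 \<le> (1 / real J)\<^sup>2 * (\<Sum>j = 1..J. norm (G (\<Theta> J n \<omega>, U (Suc n) j \<omega>)))\<^sup>2"
      using power_mono[of "norm (S \<omega>)" _ 2] unfolding power_mult_distrib[symmetric] by simp
    also have "\<dots> \<le> (1 / real J)\<^sup>2 * (real J * (\<Sum>j = 1..J. (norm (G (\<Theta> J n \<omega>, U (Suc n) j \<omega>)))\<^sup>2))"
      using sum_squared_le_sum_of_squares[of "\<lambda>j. norm (G (\<Theta> J n \<omega>, U (Suc n) j \<omega>))" "{1..J}"]
      by (intro mult_left_mono) (auto simp: mult.commute)
    also have "\<dots> = (1 / real J) * (\<Sum>j = 1..J. (norm (G (\<Theta> J n \<omega>, U (Suc n) j \<omega>)))\<^sup>2)"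
      using J by (simp add: power2_eq_square)
    finally show ?thesis .
  qed
  have "(\<integral>\<omega>. (norm (S \<omega>))\<^sup>2 \<partial>M) \<le> (\<integral>\<omega>. (1 / real J) * (\<Sum>j = 1..J. (norm (G (\<Theta> J n \<omega>, U (Suc n) j \<omega>)))\<^sup>2) \<partial>M)"
    using square_integrable_norm[OF square_integrable_sample(1)[OF J]] square_integrable_norm[OF S] norm_S
    by (intro integral_mono) auto
  also have "\<dots> = (1 / real J) * (\<Sum>j = 1..J. \<integral>\<omega>. (norm (G (\<Theta> J n \<omega>, U (Suc n) j \<omega>)))\<^sup>2 \<partial>M)"
    using square_integrable_norm[OF square_integrable_sample(1)[OF J]] by simp
  also have "\<dots> \<le> (1 / real J) * (\<Sum>j = 1..J. K)"
    by (intro mult_left_mono sum_mono square_integrable_sample(2)[OF J]) auto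
  also have "\<dots> = K" using J by simp
  finally have S_le: "(\<integral>\<omega>. (norm (S \<omega>))\<^sup>2 \<partial>M) \<le> K" .
  have "(\<integral>\<omega>. (norm (m J (Suc n) \<omega>))\<^sup>2 \<partial>M) \<le> (\<integral>\<omega>. \<alpha> * (norm (m J n \<omega>))\<^sup>2 + (1 - \<alpha>) * (norm (S \<omega>))\<^sup>2 \<partial>M)"
    using square_integrable_norm[OF square_integrable_process(2)[OF J]] square_integrable_norm[OF S] \<alpha>
      norm_convex_square[of \<alpha> "m J n _" "S _"]
    by (intro integral_mono) (auto simp: Suc_steps(2)[OF J] S_def)
  also have "\<dots> = \<alpha> * (\<integral>\<omega>. (norm (m J n \<omega>))\<^sup>2 \<partial>M) + (1 - \<alpha>) * (\<integral>\<omega>. (norm (S \<omega>))\<^sup>2 \<partial>M)"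
    using square_integrable_norm[OF square_integrable_process(2)[OF J]] square_integrable_norm[OF S] by simp
  also have "\<dots> \<le> \<alpha> * K + (1 - \<alpha>) * K"
    using Suc S_le \<alpha> by (intro add_mono mult_left_mono) auto
  finally show ?case by (simp add: algebra_simps)
qed

text \<open>Subtracting \<open>2 * \<Gamma>^2 * K\<close> closes the induction: if
  \<open>v (n + 1) \<le> 2 * v n + D\<close>, then \<open>v n + D\<close> at most doubles. The
  growth is harmless since only finitely many initial indices are treated this way.\<close>

lemma error_second_moment:
  assumes J: "1 \<le> J"
  shows "(\<integral>\<omega>. (norm (\<Theta> J n \<omega> - \<theta>star))\<^sup>2 \<partial>M) \<le> 2 ^ n * ((norm (\<xi> - \<theta>star))\<^sup>2 + 2 * \<Gamma>\<^sup>2 * K) - 2 * \<Gamma>\<^sup>2 * K"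
proof (induction n)
  case 0
  have "(\<integral>\<omega>. (norm (\<Theta> J 0 \<omega> - \<theta>star))\<^sup>2 \<partial>M) = (\<integral>\<omega>. (norm (\<xi> - \<theta>star))\<^sup>2 \<partial>M)"
    by (rule Bochner_Integration.integral_cong) (auto simp: \<Theta>_0[OF J])
  then show ?case by (simp add: prob_space)
next
  case (Suc n)
  have le: "(norm (\<Theta> J (Suc n) \<omega> - \<theta>star))\<^sup>2 \<le> 2 * (norm (\<Theta> J n \<omega> - \<theta>star))\<^sup>2 + 2 * \<Gamma>\<^sup>2 * (norm (m J (Suc n) \<omega>))\<^sup>2"
    if "\<omega> \<in> space M" for \<omega>
  proof -
    have "(\<gamma> (Suc n))\<^sup>2 * (norm (m J (Suc n) \<omega>))\<^sup>2 \<le> \<Gamma>\<^sup>2 * (norm (m J (Suc n) \<omega>))\<^sup>2"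
      using \<gamma>_le \<gamma>_nonneg by (intro mult_right_mono power_mono) auto
    moreover have eq: "\<Theta> J (Suc n) \<omega> - \<theta>star = \<Theta> J n \<omega> - \<theta>star - \<gamma> (Suc n) *\<^sub>R m J (Suc n) \<omega>"
      using Suc_steps(1)[OF J that] by simp
    ultimately show ?thesis
      using norm_diff_square_le[of "\<Theta> J n \<omega> - \<theta>star" "\<gamma> (Suc n) *\<^sub>R m J (Suc n) \<omega>"]
      unfolding eq by (simp add: power_mult_distrib)
  qed
  have "(\<integral>\<omega>. (norm (\<Theta> J (Suc n) \<omega> - \<theta>star))\<^sup>2 \<partial>M)
      \<le> (\<integral>\<omega>. 2 * (norm (\<Theta> J n \<omega> - \<theta>star))\<^sup>2 + 2 * \<Gamma>\<^sup>2 * (norm (m J (Suc n) \<omega>))\<^sup>2 \<partial>M)"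
    using le square_integrable_norm[OF square_integrable_error[OF J]]
      square_integrable_norm[OF square_integrable_process(2)[OF J]]
    by (intro integral_mono) auto
  also have "\<dots> = 2 * (\<integral>\<omega>. (norm (\<Theta> J n \<omega> - \<theta>star))\<^sup>2 \<partial>M) + 2 * \<Gamma>\<^sup>2 * (\<integral>\<omega>. (norm (m J (Suc n) \<omega>))\<^sup>2 \<partial>M)"
    using square_integrable_norm[OF square_integrable_error[OF J]]
      square_integrable_norm[OF square_integrable_process(2)[OF J]] by simp
  also have "\<dots> \<le> 2 * (2 ^ n * ((norm (\<xi> - \<theta>star))\<^sup>2 + 2 * \<Gamma>\<^sup>2 * K) - 2 * \<Gamma>\<^sup>2 * K) + 2 * \<Gamma>\<^sup>2 * K"
    by (intro add_mono mult_left_mono Suc momentum_second_moment J) auto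
  finally show ?case by (simp add: algebra_simps)
qed

section \<open>The Lyapunov function in expectation\<close>

definition lyapunov :: "(nat \<Rightarrow> real) \<Rightarrow> nat \<Rightarrow> nat \<Rightarrow> real" where
  "lyapunov b J n = (\<integral>\<omega>. (norm (\<Theta> J n \<omega> - \<theta>star - b n *\<^sub>R m J n \<omega>))\<^sup>2 + (\<gamma> n)\<^sup>2 * (norm (m J n \<omega>))\<^sup>2 \<partial>M)"

lemma square_integrable_shifted:
  assumes "1 \<le> J"
  shows "square_integrable M (\<lambda>\<omega>. \<Theta> J n \<omega> - \<theta>star - r *\<^sub>R m J n \<omega>)"
  by (intro square_integrable_diff square_integrable_error square_integrable_scaleR square_integrable_process assms)

lemma lyapunov_eq:
  assumes "1 \<le> J"
  shows "lyapunov b J n = (\<integral>\<omega>. (norm (\<Theta> J n \<omega> - \<theta>star - b n *\<^sub>R m J n \<omega>))\<^sup>2 \<partial>M) + (\<gamma> n)\<^sup>2 * (\<integral>\<omega>. (norm (m J n \<omega>))\<^sup>2 \<partial>M)"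
  using square_integrable_norm[OF square_integrable_shifted[OF assms, of n "b n"]]
    square_integrable_norm[OF square_integrable_process(2)[OF assms, of n]]
  by (simp add: lyapunov_def)

text \<open>The new shifted error and momentum split into the past-measurable parts \<open>Z\<close>
  and \<open>Q\<close> plus multiples of the mean noise. The deterministic contraction applies
  pointwise to \<open>Z\<close> and \<open>Q\<close>; each noise part adds at most
  \<open>(\<gamma> (Suc n))^2 * (K / real J)\<close>, whence the factor 2.\<close>

lemma lyapunov_step:
  fixes b :: "nat \<Rightarrow> real"
  defines "A \<equiv> \<alpha> / (1 - \<alpha>)" and "p \<equiv> (1 - \<alpha>) / 2"
  assumes J: "1 \<le> J" and n: "1 \<le> n"
    and b: "\<And>n. b n = \<alpha> * (\<gamma> (Suc n) + b (Suc n))" "\<And>n. 0 \<le> b n" "\<And>n. b n \<le> A * \<gamma> (Suc n)"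
    and small: "\<gamma> (Suc n) * (2 + A\<^sup>2 / p) \<le> (1 - \<alpha>) * c" "\<gamma> (Suc n) * (c * (2 * A\<^sup>2 + 1)) \<le> 1"
  shows "lyapunov b J (Suc n) \<le> (1 - p * c * \<gamma> (Suc n)) * lyapunov b J n + 2 * (\<gamma> (Suc n))\<^sup>2 * (K / real J)"
proof -
  define a where "a = (1 - \<alpha>) * (\<gamma> (Suc n) + b (Suc n))"
  define Z where "Z \<omega> = \<Theta> J n \<omega> - \<theta>star - b n *\<^sub>R m J n \<omega> - a *\<^sub>R g (\<Theta> J n \<omega>)" for \<omega>
  define Q where "Q \<omega> = \<alpha> *\<^sub>R m J n \<omega> + (1 - \<alpha>) *\<^sub>R g (\<Theta> J n \<omega>)" for \<omega>
  have a: "(1 - \<alpha>) * \<gamma> (Suc n) \<le> a" "a \<le> \<gamma> (Suc n)" "0 \<le> a"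
  proof -
    show "(1 - \<alpha>) * \<gamma> (Suc n) \<le> a" unfolding a_def using \<alpha> b(2)[of "Suc n"] by (intro mult_left_mono) auto
    show "0 \<le> a" unfolding a_def using \<alpha> b(2)[of "Suc n"] \<gamma>_nonneg[of "Suc n"] by simp
    \<comment> \<open>The upper bound on \<open>a\<close> follows from the decrease of the step
      sizes and \<open>(1 - \<alpha>) * (1 + A) = 1\<close>.\<close>
    have "A * \<gamma> (Suc (Suc n)) \<le> A * \<gamma> (Suc n)"
      using \<alpha> by (intro mult_left_mono \<gamma>_antimono) (auto simp: A_def)
    then have "a \<le> (1 - \<alpha>) * (\<gamma> (Suc n) + A * \<gamma> (Suc n))"
      unfolding a_def using \<alpha> b(3)[of "Suc n"] by (intro mult_left_mono) auto
    also have "\<dots> = \<gamma> (Suc n)" using \<alpha> by (simp add: A_def field_simps)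
    finally show "a \<le> \<gamma> (Suc n)" .
  qed
  note [measurable] = adapted[OF J order_refl, of n]
  have Z: "Z \<in> F (past n) \<rightarrow>\<^sub>M borel" "square_integrable M Z"
  proof -
    show "Z \<in> F (past n) \<rightarrow>\<^sub>M borel" unfolding Z_def by measurable
    show "square_integrable M Z"
      unfolding Z_def
      by (intro square_integrable_diff[OF square_integrable_shifted[OF J]] square_integrable_scaleR square_integrable_g J)
  qed
  have Q: "Q \<in> F (past n) \<rightarrow>\<^sub>M borel" "square_integrable M Q"
  proof -
    show "Q \<in> F (past n) \<rightarrow>\<^sub>M borel" unfolding Q_def by measurable
    show "square_integrable M Q"
      unfolding Q_def
      by (intro square_integrable_add square_integrable_scaleR square_integrable_process square_integrable_g J)
  qed
  have mS: "m J (Suc n) \<omega> = Q \<omega> + (1 - \<alpha>) *\<^sub>R mean_noise J n \<omega>" if "\<omega> \<in> space M" for \<omega>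
    using m_noise_step[OF J that] by (simp add: Q_def)
  have zS: "\<Theta> J (Suc n) \<omega> - \<theta>star - b (Suc n) *\<^sub>R m J (Suc n) \<omega> = Z \<omega> + (- a) *\<^sub>R mean_noise J n \<omega>"
    if "\<omega> \<in> space M" for \<omega>
  proof -
    \<comment> \<open>Substituting the position update gives the old error minus \<open>s\<close>
      times the new momentum. As \<open>s * \<alpha> = b n\<close>, the old momentum reappears with
      exactly its old weight, and gradient and noise receive the weight
      \<open>s * (1 - \<alpha>) = a\<close>.\<close>
    define s where "s = \<gamma> (Suc n) + b (Suc n)"
    have "\<Theta> J (Suc n) \<omega> - \<theta>star - b (Suc n) *\<^sub>R m J (Suc n) \<omega> = \<Theta> J n \<omega> - \<theta>star - s *\<^sub>R m J (Suc n) \<omega>"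
      using Suc_steps(1)[OF J that] by (simp add: s_def algebra_simps)
    moreover have "b n = s * \<alpha>" "a = s * (1 - \<alpha>)" using b(1)[of n] by (auto simp: s_def a_def)
    ultimately show ?thesis
      unfolding Z_def mS[OF that] Q_def by (simp add: scaleR_add_right)
  qed
  have "(\<integral>\<omega>. (norm (\<Theta> J (Suc n) \<omega> - \<theta>star - b (Suc n) *\<^sub>R m J (Suc n) \<omega>))\<^sup>2 \<partial>M)
      = (\<integral>\<omega>. (norm (Z \<omega> + (- a) *\<^sub>R mean_noise J n \<omega>))\<^sup>2 \<partial>M)"
    by (rule Bochner_Integration.integral_cong) (auto simp only: zS)
  also have "\<dots> \<le> (\<integral>\<omega>. (norm (Z \<omega>))\<^sup>2 \<partial>M) + (- a)\<^sup>2 * (K / real J)"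
    by (rule integral_norm_square_add_mean_noise[OF J Z])
  also have "(- a)\<^sup>2 * (K / real J) \<le> (\<gamma> (Suc n))\<^sup>2 * (K / real J)"
    using a K_nonneg by (intro mult_right_mono) (auto intro: power_mono)
  finally have zE: "(\<integral>\<omega>. (norm (\<Theta> J (Suc n) \<omega> - \<theta>star - b (Suc n) *\<^sub>R m J (Suc n) \<omega>))\<^sup>2 \<partial>M)
      \<le> (\<integral>\<omega>. (norm (Z \<omega>))\<^sup>2 \<partial>M) + (\<gamma> (Suc n))\<^sup>2 * (K / real J)" by simp
  have "(\<integral>\<omega>. (norm (m J (Suc n) \<omega>))\<^sup>2 \<partial>M) = (\<integral>\<omega>. (norm (Q \<omega> + (1 - \<alpha>) *\<^sub>R mean_noise J n \<omega>))\<^sup>2 \<partial>M)"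
    by (rule Bochner_Integration.integral_cong) (auto simp only: mS)
  also have "\<dots> \<le> (\<integral>\<omega>. (norm (Q \<omega>))\<^sup>2 \<partial>M) + (1 - \<alpha>)\<^sup>2 * (K / real J)"
    by (rule integral_norm_square_add_mean_noise[OF J Q])
  also have "(1 - \<alpha>)\<^sup>2 * (K / real J) \<le> 1 * (K / real J)"
    using \<alpha> K_nonneg by (intro mult_right_mono) (auto simp: power_le_one)
  finally have mE: "(\<gamma> (Suc n))\<^sup>2 * (\<integral>\<omega>. (norm (m J (Suc n) \<omega>))\<^sup>2 \<partial>M)
      \<le> (\<gamma> (Suc n))\<^sup>2 * ((\<integral>\<omega>. (norm (Q \<omega>))\<^sup>2 \<partial>M) + K / real J)"
    by (intro mult_left_mono) auto
  have "(\<integral>\<omega>. (norm (Z \<omega>))\<^sup>2 \<partial>M) + (\<gamma> (Suc n))\<^sup>2 * (\<integral>\<omega>. (norm (Q \<omega>))\<^sup>2 \<partial>M)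
      = (\<integral>\<omega>. (norm (Z \<omega>))\<^sup>2 + (\<gamma> (Suc n))\<^sup>2 * (norm (Q \<omega>))\<^sup>2 \<partial>M)"
    using square_integrable_norm[OF Z(2)] square_integrable_norm[OF Q(2)] by simp
  also have "\<dots> \<le> (\<integral>\<omega>. (1 - p * c * \<gamma> (Suc n))
      * ((norm (\<Theta> J n \<omega> - \<theta>star - b n *\<^sub>R m J n \<omega>))\<^sup>2 + (\<gamma> n)\<^sup>2 * (norm (m J n \<omega>))\<^sup>2) \<partial>M)"
  proof (rule integral_mono)
    show "(norm (Z \<omega>))\<^sup>2 + (\<gamma> (Suc n))\<^sup>2 * (norm (Q \<omega>))\<^sup>2 \<le> (1 - p * c * \<gamma> (Suc n))
      * ((norm (\<Theta> J n \<omega> - \<theta>star - b n *\<^sub>R m J n \<omega>))\<^sup>2 + (\<gamma> n)\<^sup>2 * (norm (m J n \<omega>))\<^sup>2)" for \<omega>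
      unfolding Z_def Q_def p_def
    proof (rule momentum_lyapunov_step[OF \<alpha> c _ _ a(1,2) b(2) b(3)[unfolded A_def] g_coercive small[unfolded A_def p_def]])
      show "\<gamma> (Suc n) \<le> \<gamma> n" using n by (intro \<gamma>_antimono) auto
      show "0 < \<gamma> (Suc n)" by (simp add: \<gamma>_pos)
    qed
  qed (use square_integrable_norm[OF Z(2)] square_integrable_norm[OF Q(2)]
      square_integrable_norm[OF square_integrable_shifted[OF J]]
      square_integrable_norm[OF square_integrable_process(2)[OF J]] in \<open>simp_all\<close>)
  also have "\<dots> = (1 - p * c * \<gamma> (Suc n)) * lyapunov b J n"
    by (simp add: lyapunov_def)
  finally show ?thesis
    using zE mE unfolding lyapunov_eq[OF J, of b "Suc n"] distrib_left by linarith
qed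

text \<open>The error is the shifted error plus \<open>b n *\<^sub>R m J n\<close>. Since
  \<open>b n \<le> A * \<gamma> n\<close>, the weight \<open>\<gamma>^2\<close> on the momentum is
  just enough to control the shift.\<close>

lemma error_le_lyapunov:
  assumes J: "1 \<le> J" and b: "0 \<le> b n" "b n \<le> A * \<gamma> n"
  shows "(\<integral>\<omega>. (norm (\<Theta> J n \<omega> - \<theta>star))\<^sup>2 \<partial>M) \<le> (2 + 2 * A\<^sup>2) * lyapunov b J n"
proof -
  have "(norm (\<Theta> J n \<omega> - \<theta>star))\<^sup>2
      \<le> (2 + 2 * A\<^sup>2) * ((norm (\<Theta> J n \<omega> - \<theta>star - b n *\<^sub>R m J n \<omega>))\<^sup>2 + (\<gamma> n)\<^sup>2 * (norm (m J n \<omega>))\<^sup>2)" for \<omega>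
  proof -
    let ?z = "(norm (\<Theta> J n \<omega> - \<theta>star - b n *\<^sub>R m J n \<omega>))\<^sup>2" and ?m = "(\<gamma> n)\<^sup>2 * (norm (m J n \<omega>))\<^sup>2"
    have "(norm (\<Theta> J n \<omega> - \<theta>star))\<^sup>2 \<le> 2 * ?z + 2 * ((b n)\<^sup>2 * (norm (m J n \<omega>))\<^sup>2)"
      using norm_diff_square_le[of "\<Theta> J n \<omega> - \<theta>star - b n *\<^sub>R m J n \<omega>" "- (b n *\<^sub>R m J n \<omega>)"]
      by (simp add: power_mult_distrib)
    also have "(b n)\<^sup>2 * (norm (m J n \<omega>))\<^sup>2 \<le> (A * \<gamma> n)\<^sup>2 * (norm (m J n \<omega>))\<^sup>2"
      using b by (intro mult_right_mono power_mono) auto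
    also have "\<dots> = A\<^sup>2 * ?m" by (simp add: power_mult_distrib)
    finally have "(norm (\<Theta> J n \<omega> - \<theta>star))\<^sup>2 \<le> 2 * ?z + 2 * (A\<^sup>2 * ?m)" by simp
    moreover have "0 \<le> A\<^sup>2 * ?z" "0 \<le> ?m" by simp_all
    ultimately show ?thesis unfolding distrib_left distrib_right by linarith
  qed
  then have "(\<integral>\<omega>. (norm (\<Theta> J n \<omega> - \<theta>star))\<^sup>2 \<partial>M) \<le> (\<integral>\<omega>. (2 + 2 * A\<^sup>2) *
      ((norm (\<Theta> J n \<omega> - \<theta>star - b n *\<^sub>R m J n \<omega>))\<^sup>2 + (\<gamma> n)\<^sup>2 * (norm (m J n \<omega>))\<^sup>2) \<partial>M)"
    using square_integrable_norm[OF square_integrable_error[OF J]]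
      square_integrable_norm[OF square_integrable_shifted[OF J]]
      square_integrable_norm[OF square_integrable_process(2)[OF J]]
    by (intro integral_mono) auto
  then show ?thesis by (simp add: lyapunov_def)
qed

text \<open>Provides a starting value for the recursion that is independent of \<open>J\<close>,
  using the a priori bounds and \<open>\<gamma> n \<le> \<Gamma>\<close>.\<close>

lemma lyapunov_le_error:
  assumes J: "1 \<le> J" and b: "0 \<le> b n" "b n \<le> A * \<gamma> n"
  shows "lyapunov b J n \<le> 2 * (\<integral>\<omega>. (norm (\<Theta> J n \<omega> - \<theta>star))\<^sup>2 \<partial>M) + (2 * A\<^sup>2 + 1) * (\<Gamma>\<^sup>2 * K)"
proof -
  let ?M = "\<integral>\<omega>. (norm (m J n \<omega>))\<^sup>2 \<partial>M"
  note int = square_integrable_norm[OF square_integrable_error[OF J, of n]]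
      square_integrable_norm[OF square_integrable_shifted[OF J, of n "b n"]]
      square_integrable_norm[OF square_integrable_process(2)[OF J, of n]]
  have "(norm (\<Theta> J n \<omega> - \<theta>star - b n *\<^sub>R m J n \<omega>))\<^sup>2
      \<le> 2 * (norm (\<Theta> J n \<omega> - \<theta>star))\<^sup>2 + 2 * (b n)\<^sup>2 * (norm (m J n \<omega>))\<^sup>2" for \<omega>
    using norm_diff_square_le[of "\<Theta> J n \<omega> - \<theta>star" "b n *\<^sub>R m J n \<omega>"] by (simp add: power_mult_distrib)
  then have "(\<integral>\<omega>. (norm (\<Theta> J n \<omega> - \<theta>star - b n *\<^sub>R m J n \<omega>))\<^sup>2 \<partial>M)
      \<le> (\<integral>\<omega>. 2 * (norm (\<Theta> J n \<omega> - \<theta>star))\<^sup>2 + 2 * (b n)\<^sup>2 * (norm (m J n \<omega>))\<^sup>2 \<partial>M)"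
    using int by (intro integral_mono) auto
  also have "\<dots> = 2 * (\<integral>\<omega>. (norm (\<Theta> J n \<omega> - \<theta>star))\<^sup>2 \<partial>M) + 2 * (b n)\<^sup>2 * ?M"
    using int by simp
  finally have "lyapunov b J n \<le> 2 * (\<integral>\<omega>. (norm (\<Theta> J n \<omega> - \<theta>star))\<^sup>2 \<partial>M) + (2 * (b n)\<^sup>2 + (\<gamma> n)\<^sup>2) * ?M"
    by (simp add: lyapunov_eq[OF J] algebra_simps)
  moreover have "(2 * (b n)\<^sup>2 + (\<gamma> n)\<^sup>2) * ?M \<le> ((2 * A\<^sup>2 + 1) * \<Gamma>\<^sup>2) * K"
  proof (intro mult_mono momentum_second_moment J)
    have "(b n)\<^sup>2 \<le> (A * \<gamma> n)\<^sup>2" using b by (intro power_mono) auto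
    then have "2 * (b n)\<^sup>2 + (\<gamma> n)\<^sup>2 \<le> (2 * A\<^sup>2 + 1) * (\<gamma> n)\<^sup>2" by (simp add: power_mult_distrib algebra_simps)
    also have "\<dots> \<le> (2 * A\<^sup>2 + 1) * \<Gamma>\<^sup>2"
      using \<gamma>_le \<gamma>_nonneg by (intro mult_left_mono power_mono) auto
    finally show "2 * (b n)\<^sup>2 + (\<gamma> n)\<^sup>2 \<le> (2 * A\<^sup>2 + 1) * \<Gamma>\<^sup>2" .
  qed auto
  ultimately show ?thesis by (simp add: mult.assoc)
qed

section \<open>Choice of the starting index and the final rate\<close>

lemma eventually_\<gamma>_small:
  "\<forall>\<^sub>F n in sequentially. \<gamma> n * C \<le> e" if "0 < e"
proof -
  have "(\<lambda>n. real n powr (- l)) \<longlonglongrightarrow> 0"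
    by (rule tendsto_neg_powr) (use l in \<open>auto intro: filterlim_real_sequentially\<close>)
  then have "(\<lambda>n. \<gamma> n * C) \<longlonglongrightarrow> \<Gamma> * 0 * C" unfolding \<gamma>_def by (intro tendsto_intros)
  then have "\<forall>\<^sub>F n in sequentially. \<gamma> n * C < e" by (rule order_tendstoD) (use that in simp)
  then show ?thesis by eventually_elim simp
qed

text \<open>Here \<open>l < 1\<close> enters: \<open>1 / n\<close> is \<open>n powr (- l)\<close>
  times the null sequence \<open>n powr (- (1 - l))\<close>. A factor 2 accounts for
  \<open>n - 1\<close> in place of \<open>n\<close>.\<close>

lemma eventually_inverse_le_powr:
  assumes "0 < h"
  shows "\<forall>\<^sub>F n in sequentially. 1 / real (n - 1) \<le> h * real n powr (- l)"
proof -
  have "(\<lambda>n. real n powr (- (1 - l))) \<longlonglongrightarrow> 0"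
    by (rule tendsto_neg_powr) (use l in \<open>auto intro: filterlim_real_sequentially\<close>)
  then have "\<forall>\<^sub>F n in sequentially. real n powr (- (1 - l)) < h / 2"
    by (rule order_tendstoD) (use assms in simp)
  then show ?thesis
    using eventually_ge_at_top[of 2]
  proof eventually_elim
    case (elim n)
    have "1 / real (n - 1) \<le> 2 * (1 / real n)"
      using elim(2) by (simp add: field_simps of_nat_diff)
    also have "1 / real n = real n powr (- (1 - l)) * real n powr (- l)"
      using elim(2) powr_add[of "real n" "- (1 - l)" "- l"] by (simp add: powr_neg_one)
    also have "2 * (real n powr (- (1 - l)) * real n powr (- l)) \<le> 2 * (h / 2 * real n powr (- l))"
      using elim(1) by (intro mult_left_mono mult_right_mono) auto
    finally show ?case by simp
  qed
qed

lemma convergence_rate: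
  obtains N P R \<mu> Q where "0 \<le> P" "0 \<le> R" "0 < \<mu>" "0 \<le> Q"
    and "\<And>J n. 1 \<le> J \<Longrightarrow> n \<le> N \<Longrightarrow> (\<integral>\<omega>. (norm (\<Theta> J n \<omega> - \<theta>star))\<^sup>2 \<partial>M) \<le> R"
    and "\<And>J n. 1 \<le> J \<Longrightarrow> N \<le> n \<Longrightarrow> (\<integral>\<omega>. (norm (\<Theta> J n \<omega> - \<theta>star))\<^sup>2 \<partial>M)
      \<le> P * exp (- (\<mu> * real n powr (1 - l))) + Q * (inverse (real J) * real n powr (- l))"
proof -
  define A where "A = \<alpha> / (1 - \<alpha>)"
  define p where "p = (1 - \<alpha>) / 2"
  have p: "0 < p" and A: "0 \<le> A" using \<alpha> by (auto simp: p_def A_def)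
  obtain b where b: "\<And>n. b n = \<alpha> * (\<gamma> (Suc n) + b (Suc n))" "\<And>n. 0 \<le> b n" "\<And>n. b n \<le> A * \<gamma> (Suc n)"
    unfolding A_def using momentum_weights[OF \<alpha>, of \<gamma>] \<gamma>_nonneg \<gamma>_antimono by metis
  have b': "b n \<le> A * \<gamma> n" if "1 \<le> n" for n
    using b(3)[of n] mult_left_mono[OF \<gamma>_antimono[OF that, of "Suc n"] A] by simp
  define h where "h = p * c * \<Gamma>"
  have h: "0 < h" using p c \<Gamma> by (simp add: h_def)
  \<comment> \<open>The first two conditions serve \<open>lyapunov_step\<close>; the last two are
    \<open>small\<close> and \<open>slow\<close> of \<open>recursion_bound\<close>, with
    \<open>h\<close> chosen so that
    \<open>p * c * \<gamma> n = h * real n powr (- l)\<close>.\<close>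
  have "\<forall>\<^sub>F n in sequentially. \<gamma> n * (2 + A\<^sup>2 / p) \<le> (1 - \<alpha>) * c \<and> \<gamma> n * (c * (2 * A\<^sup>2 + 1)) \<le> 1
      \<and> \<gamma> n * (p * c) \<le> 1 \<and> 1 / real (n - 1) \<le> h / 2 * real n powr (- l)"
    using \<alpha> c h by (intro eventually_conj eventually_\<gamma>_small eventually_inverse_le_powr) auto
  then obtain N0 where N0: "\<And>n. N0 \<le> n \<Longrightarrow> \<gamma> n * (2 + A\<^sup>2 / p) \<le> (1 - \<alpha>) * c \<and> \<gamma> n * (c * (2 * A\<^sup>2 + 1)) \<le> 1
      \<and> \<gamma> n * (p * c) \<le> 1 \<and> 1 / real (n - 1) \<le> h / 2 * real n powr (- l)"
    unfolding eventually_sequentially by auto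
  \<comment> \<open>At least 1, so that the step sizes decrease and \<open>b'\<close> holds from
    \<open>N\<close> on.\<close>
  define N where "N = max 1 N0"
  define R where "R = 2 ^ N * ((norm (\<xi> - \<theta>star))\<^sup>2 + 2 * \<Gamma>\<^sup>2 * K)"
  define B where "B = 2 * R + (2 * A\<^sup>2 + 1) * (\<Gamma>\<^sup>2 * K)"
  have N: "1 \<le> N" by (simp add: N_def)
  have R: "0 \<le> R" using K_nonneg by (simp add: R_def)
  have B: "0 \<le> B" using R K_nonneg by (simp add: B_def)
  have early: "(\<integral>\<omega>. (norm (\<Theta> J n \<omega> - \<theta>star))\<^sup>2 \<partial>M) \<le> R" if "1 \<le> J" "n \<le> N" for J n
  proof -
    have "(2::real) ^ n * ((norm (\<xi> - \<theta>star))\<^sup>2 + 2 * \<Gamma>\<^sup>2 * K) \<le> R"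
      unfolding R_def using that K_nonneg by (intro mult_right_mono power_increasing) auto
    moreover have "0 \<le> 2 * \<Gamma>\<^sup>2 * K" using K_nonneg by simp
    ultimately show ?thesis using error_second_moment[OF that(1), of n] by linarith
  qed
  define E where "E = (2 + 2 * A\<^sup>2)"
  have E: "0 \<le> E" by (simp add: E_def)
  define P where "P = E * (B * exp (h * real N powr (1 - l)))"
  \<comment> \<open>The recursion has noise coefficient \<open>q = 2 * \<Gamma>^2 * K / J\<close>;
    this is \<open>2 * q / h\<close> without its factor \<open>1 / J\<close>, times the comparison
    constant \<open>E\<close>.\<close>
  define Q where "Q = E * (4 * \<Gamma>\<^sup>2 * K / h)"
  have late: "(\<integral>\<omega>. (norm (\<Theta> J n \<omega> - \<theta>star))\<^sup>2 \<partial>M)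
      \<le> P * exp (- (h * real n powr (1 - l))) + Q * (inverse (real J) * real n powr (- l))"
    if J: "1 \<le> J" and n: "N \<le> n" for J n
  proof -
    have "lyapunov b J n \<le> B * exp (h * real N powr (1 - l)) * exp (- (h * real n powr (1 - l)))
           + 2 * (2 * \<Gamma>\<^sup>2 * (K / real J)) / h * real n powr (- l)"
    proof (rule recursion_bound[OF l h _ B N])
      fix k assume k: "N < k"
      then have k': "N0 \<le> k" "1 \<le> k - 1" "Suc (k - 1) = k" by (auto simp: N_def)
      show "h * real k powr (- l) \<le> 1" "1 / real (k - 1) \<le> h / 2 * real k powr (- l)"
        using N0[OF k'(1)] by (auto simp: h_def \<gamma>_def mult_ac)
      show "lyapunov b J k \<le> (1 - h * real k powr (- l)) * lyapunov b J (k - 1)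
          + 2 * \<Gamma>\<^sup>2 * (K / real J) * (real k powr (- l))\<^sup>2"
        using lyapunov_step[OF J k'(2) b[unfolded A_def]] N0[OF k'(1)]
        unfolding k'(3) A_def p_def h_def \<gamma>_def by (simp add: power_mult_distrib mult_ac)
    next
      show "lyapunov b J N \<le> B"
        using lyapunov_le_error[of J b N A] J b(2) b'[OF N] early[OF J, of N] unfolding B_def by fastforce
    qed (use K_nonneg n in auto)
    then have "E * lyapunov b J n \<le> E * (B * exp (h * real N powr (1 - l)) * exp (- (h * real n powr (1 - l)))
           + 2 * (2 * \<Gamma>\<^sup>2 * (K / real J)) / h * real n powr (- l))"
      using E by (intro mult_left_mono) auto
    also have "\<dots> = P * exp (- (h * real n powr (1 - l))) + Q * (inverse (real J) * real n powr (- l))"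
      by (simp add: P_def Q_def distrib_left divide_inverse mult_ac)
    finally show ?thesis
      using error_le_lyapunov[of J b n A] J b(2) b' n N unfolding E_def by fastforce
  qed
  show ?thesis
  proof (rule that[OF _ R h _ early late])
    show "0 \<le> P" "0 \<le> Q" using E B h K_nonneg by (auto simp: P_def Q_def)
  qed
qed

theorem strong_error_bound:
  "\<exists>C > (0::real). \<forall>J \<ge> 1. \<forall>n \<ge> 1.
     (\<integral>\<^sup>+ \<omega>. ennreal ((norm (\<Theta> J n \<omega> - \<theta>star))\<^sup>2) \<partial>M)
       \<le> ennreal (C * (exp (- (inverse C * real n powr (1 - l))) + inverse (real J) * real n powr (- l)))"
proof (rule convergence_rate)
  fix N P R \<mu> Q assume nonneg: "0 \<le> P" "0 \<le> R" "0 < \<mu>" "0 \<le> Q"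
    and early: "\<And>J n. 1 \<le> J \<Longrightarrow> n \<le> N \<Longrightarrow> (\<integral>\<omega>. (norm (\<Theta> J n \<omega> - \<theta>star))\<^sup>2 \<partial>M) \<le> R"
    and late: "\<And>J n. 1 \<le> J \<Longrightarrow> N \<le> n \<Longrightarrow> (\<integral>\<omega>. (norm (\<Theta> J n \<omega> - \<theta>star))\<^sup>2 \<partial>M)
      \<le> P * exp (- (\<mu> * real n powr (1 - l))) + Q * (inverse (real J) * real n powr (- l))"
  \<comment> \<open>\<open>P\<close> and \<open>Q\<close> cover the prefactors and
    \<open>1 / \<mu>\<close> the rate. For \<open>n \<le> N\<close> the summand
    \<open>real N\<close> keeps the exponential above \<open>exp (- 1)\<close>, which
    \<open>R * exp 1\<close> compensates. The summand 1 ensures positivity.\<close>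
  define C where "C = 1 + P + R * exp 1 + 1 / \<mu> + Q + real N"
  have C: "1 \<le> C" "P \<le> C" "R * exp 1 \<le> C" "1 / \<mu> \<le> C" "Q \<le> C" "real N \<le> C"
    using nonneg by (auto simp: C_def)
  have bound: "(\<integral>\<omega>. (norm (\<Theta> J n \<omega> - \<theta>star))\<^sup>2 \<partial>M)
      \<le> C * (exp (- (inverse C * real n powr (1 - l))) + inverse (real J) * real n powr (- l))"
    if J: "1 \<le> J" and n: "1 \<le> n" for J n
  proof (cases "n \<le> N")
    case True
    have "real n powr (1 - l) \<le> real n powr 1" using n l by (intro powr_mono) auto
    also have "\<dots> \<le> C" using True C by simp
    finally have "inverse C * real n powr (1 - l) \<le> 1" using C(1) by (simp add: field_simps)
    then have "exp (- 1) \<le> exp (- (inverse C * real n powr (1 - l)))" by simp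
    then have "R * exp 1 * exp (- 1) \<le> C * exp (- (inverse C * real n powr (1 - l)))"
      using C nonneg by (intro mult_mono) auto
    moreover have "R * exp 1 * exp (- 1) = R" by (simp add: exp_minus)
    moreover have "0 \<le> C * (inverse (real J) * real n powr (- l))" using C by simp
    ultimately show ?thesis using early[OF J True] unfolding distrib_left by linarith
  next
    case False
    have "inverse C \<le> \<mu>" using C nonneg by (simp add: field_simps)
    then have "exp (- (\<mu> * real n powr (1 - l))) \<le> exp (- (inverse C * real n powr (1 - l)))"
      by (simp add: mult_right_mono)
    then have "P * exp (- (\<mu> * real n powr (1 - l))) \<le> C * exp (- (inverse C * real n powr (1 - l)))"
      using C nonneg by (intro mult_mono) auto
    moreover have "Q * (inverse (real J) * real n powr (- l)) \<le> C * (inverse (real J) * real n powr (- l))"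
      using C by (intro mult_right_mono) auto
    ultimately show ?thesis using late[OF J, of n] False unfolding distrib_left by linarith
  qed
  show ?thesis
  proof (intro exI[of _ C] conjI allI impI)
    show "0 < C" using C by simp
    fix J n :: nat assume "1 \<le> J" "1 \<le> n"
    then show "(\<integral>\<^sup>+ \<omega>. ennreal ((norm (\<Theta> J n \<omega> - \<theta>star))\<^sup>2) \<partial>M)
       \<le> ennreal (C * (exp (- (inverse C * real n powr (1 - l))) + inverse (real J) * real n powr (- l)))"
      by (subst nn_integral_eq_integral[OF square_integrable_norm[OF square_integrable_error]])
        (auto intro!: ennreal_leI bound)
  qed
qed

end

theorem theorem1p1:
  fixes M :: "'a measure"
    and U :: "nat \<Rightarrow> nat \<Rightarrow> 'a \<Rightarrow> real ^ 'e"
    and G :: "(real ^ 'd) \<times> (real ^ 'e) \<Rightarrow> real ^ 'd"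
    and \<xi> \<theta>star :: "real ^ 'd"
    and \<alpha> c \<Gamma> l :: real
    and \<Theta> m :: "nat \<Rightarrow> nat \<Rightarrow> 'a \<Rightarrow> real ^ 'd"
  assumes "prob_space M"
    and "prob_space.indep_vars M (\<lambda>_. borel) (\<lambda>(n, k). U n k) UNIV"
    and "\<And>n k n' k'. distr M borel (U n k) = distr M borel (U n' k')"
    and "G \<in> borel \<Otimes>\<^sub>M borel \<rightarrow>\<^sub>M borel"
    and "0 \<le> \<alpha>" and "\<alpha> < 1" and "0 < c" and "0 < \<Gamma>" and "0 < l" and "l < 1"
    and "\<And>J \<omega>. J \<ge> 1 \<Longrightarrow> \<omega> \<in> space M \<Longrightarrow> \<Theta> J 0 \<omega> = \<xi>"
    and "\<And>J \<omega>. J \<ge> 1 \<Longrightarrow> \<omega> \<in> space M \<Longrightarrow> m J 0 \<omega> = 0"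
    and "\<And>J n \<omega>. J \<ge> 1 \<Longrightarrow> n \<ge> 1 \<Longrightarrow> \<omega> \<in> space M \<Longrightarrow>
           \<Theta> J n \<omega> = \<Theta> J (n - 1) \<omega> - (\<Gamma> * real n powr (- l)) *\<^sub>R m J n \<omega>"
    and "\<And>J n \<omega>. J \<ge> 1 \<Longrightarrow> n \<ge> 1 \<Longrightarrow> \<omega> \<in> space M \<Longrightarrow>
           m J n \<omega> = \<alpha> *\<^sub>R m J (n - 1) \<omega>
             + (1 - \<alpha>) *\<^sub>R ((1 / real J) *\<^sub>R (\<Sum>j = 1..J. G (\<Theta> J (n - 1) \<omega>, U n j \<omega>)))"
    and "\<And>\<theta>. (SUP (J, n) \<in> {1..} \<times> {1..}.
           \<integral>\<^sup>+ \<omega>. ennreal (norm (G (\<theta>, U 0 1 \<omega>)) + (norm (G (\<Theta> J (n - 1) \<omega>, U 0 1 \<omega>)))\<^sup>2) \<partial>M) < \<infinity>"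
    and "\<And>\<theta>. inner (\<theta> - \<theta>star) (\<integral>\<omega>. G (\<theta>, U 1 1 \<omega>) \<partial>M)
           \<ge> c * max ((norm (\<theta> - \<theta>star))\<^sup>2) ((norm (\<integral>\<omega>. G (\<theta>, U 1 1 \<omega>) \<partial>M))\<^sup>2)"
  shows "\<exists>C > (0::real). \<forall>J \<ge> 1. \<forall>n \<ge> 1.
           (\<integral>\<^sup>+ \<omega>. ennreal ((norm (\<Theta> J n \<omega> - \<theta>star))\<^sup>2) \<partial>M)
             \<le> ennreal (C * (exp (- (inverse C * real n powr (1 - l))) + inverse (real J) * real n powr (- l)))"
proof -
  interpret prob_space M by fact
  interpret momentum_sgd M U G \<xi> \<theta>star \<alpha> c \<Gamma> l \<Theta> m
    by unfold_locales (fact assms)+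
  show ?thesis by (rule strong_error_bound)
qed

end
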